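(* For all $(J,E)\in D$ one has $\Delta(J,E)>0$, where $$\Delta(J,E)=\det\begin{pmatrix}\frac{\partial T}{\partial E}&\frac{\partial\Psi}{\partial E}\\[1mm]\frac{\partial T}{\partial J}&\frac{\partial\Psi}{\partial J}\end{pmatrix}(J,E).$$
   Context: The setting is the bounded solutions of $W_{xx}+W-|W|^2W=0$ ($W:\mathbb{R}\to\mathbb{C}$), with conserved quantities $J=\mathrm{Im}(\overline{W}W_x)$ and $E=\frac12|W_x|^2+\frac12|W|^2-\frac14|W|^4$. Let $V_J(r)=\frac{J^2}{2r^2}+\frac{r^2}{2}-\frac{r^4}{4}$. For $J^2<4/27$ write $J=q(1-q^2)=Q(1-Q^2)$ with $0\le q^2<1/3<Q^2\le1$, and set $E_-(J)=\frac14(1-Q^2)(1+3Q^2)$, $E_+(J)=\frac14(1-q^2)(1+3q^2)$. Let $$D=\{(J,E)\in\mathbb{R}^2\mid J^2<4/27,\ E_-(J)<E<E_+(J)\}.$$ For $(J,E)\in D$ with $J\ne0$, let $r_1<r_2<r_3$ be the three positive roots of $E-V_J(r)$ and define $$T(J,E)=2\int_{r_1}^{r_2}\frac{dr}{\sqrt{2(E-V_J(r))}},\qquad \Phi(J,E)=2\int_{r_1}^{r_2}\frac{J}{r^2}\frac{dr}{\sqrt{2(E-V_J(r))}}.$$ For $J=0$, $0<E<1/4$, define $T(0,E)=2\int_0^{r_2}\frac{dr}{\sqrt{2(E-V_0(r))}}$ with $r_2=(1-\sqrt{1-4E})^{1/2}$. The renormalized phase is $\Psi(J,E)=\Phi(J,E)-\pi\,\mathrm{sign}(J)$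 if $J\ne0$ and $\Psi(0,E)=0$. The functions $T$ and $\Psi$ are smooth on $D$. *)

theory Defs
  imports "HOL-Analysis.Analysis"
begin

text \<open>
  Quasi-periodic solutions of \<open>W'' + W - |W|^2 W = 0\<close> are parametrised by the conserved
  quantities \<open>J = Im (cnj W * W')\<close> and \<open>E = |W'|^2/2 + |W|^2/2 - |W|^4/4\<close>.
  The modulus \<open>r = |W|\<close> moves in the effective potential below.
\<close>

definition eff_potential :: "real \<Rightarrow> real \<Rightarrow> real"
  where "eff_potential J r = J^2 / (2 * r^2) + r^2 / 2 - r^4 / 4"

text \<open>
  The parameters \<open>q\<close>, \<open>Q\<close> with \<open>J = q (1 - q^2) = Q (1 - Q^2)\<close>, meaningful for \<open>J^2 < 4/27\<close>.
  Both are unique, except that \<open>Q\<close> is only determined up to sign (\<open>Q = 1\<close> or \<open>Q = -1\<close>) when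
  \<open>J = 0\<close>; only \<open>Q^2\<close> is used in the sequel.
\<close>

definition small_param :: "real \<Rightarrow> real"
  where "small_param J = (SOME q. J = q * (1 - q^2) \<and> 0 \<le> q^2 \<and> q^2 < 1/3)"

definition large_param :: "real \<Rightarrow> real"
  where "large_param J = (SOME Q. J = Q * (1 - Q^2) \<and> 1/3 < Q^2 \<and> Q^2 \<le> 1)"

definition E_minus :: "real \<Rightarrow> real"
  where "E_minus J = (1/4) * (1 - (large_param J)^2) * (1 + 3 * (large_param J)^2)"

definition E_plus :: "real \<Rightarrow> real"
  where "E_plus J = (1/4) * (1 - (small_param J)^2) * (1 + 3 * (small_param J)^2)"

definition param_domain :: "(real \<times> real) set"
  where "param_domain = {(J, E). J^2 < 4/27 \<and> E_minus J < E \<and> E < E_plus J}"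

text \<open>
  For \<open>(J, E)\<close> in the domain and \<open>J \<noteq> 0\<close> there are exactly three positive roots
  \<open>r\<^sub>1 < r\<^sub>2 < r\<^sub>3\<close> of \<open>E - V\<^sub>J\<close>; \<open>turning_point J E i\<close> is the \<open>i\<close>-th smallest
  one, counted from \<open>0\<close>.
\<close>

definition positive_roots :: "real \<Rightarrow> real \<Rightarrow> real set"
  where "positive_roots J E = {r. 0 < r \<and> E - eff_potential J r = 0}"

definition turning_point :: "real \<Rightarrow> real \<Rightarrow> nat \<Rightarrow> real"
  where "turning_point J E i = sorted_list_of_set (positive_roots J E) ! i"

abbreviation r1 :: "real \<Rightarrow> real \<Rightarrow> real" where "r1 J E \<equiv> turning_point J E 0"
abbreviation r2 :: "real \<Rightarrow> real \<Rightarrow> real" where "r2 J E \<equiv> turning_point J E 1"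

text \<open>
  The integrands have inverse square root singularities at the turning points, where the
  convention \<open>1 / 0 = 0\<close> applies; this does not affect the integrals.
\<close>

definition period :: "real \<Rightarrow> real \<Rightarrow> real"
  where "period J E =
    (if J = 0
     then 2 * integral {0 .. sqrt (1 - sqrt (1 - 4 * E))}
                (\<lambda>r. 1 / sqrt (2 * (E - eff_potential 0 r)))
     else 2 * integral {r1 J E .. r2 J E}
                (\<lambda>r. 1 / sqrt (2 * (E - eff_potential J r))))"

text \<open>The phase \<open>\<Phi>\<close>, meaningful for \<open>J \<noteq> 0\<close> only.\<close>

definition phase :: "real \<Rightarrow> real \<Rightarrow> real"
  where "phase J E =
    2 * integral {r1 J E .. r2 J E}
          (\<lambda>r. J / r^2 * (1 / sqrt (2 * (E - eff_potential J r))))"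

definition renormalized_phase :: "real \<Rightarrow> real \<Rightarrow> real"
  where "renormalized_phase J E = (if J = 0 then 0 else phase J E - pi * sgn J)"

definition Delta :: "real \<Rightarrow> real \<Rightarrow> real"
  where "Delta J E =
    det (vector
      [vector [deriv (\<lambda>e. period J e) E, deriv (\<lambda>e. renormalized_phase J e) E],
       vector [deriv (\<lambda>j. period j E) J, deriv (\<lambda>j. renormalized_phase j E) J]] :: real^2^2)"

end

theory Submission
  imports Defs
begin

text \<open>
  In the variable \<open>y = r^2\<close> the turning points are the roots \<open>a < b < c\<close> of the cubic
  \<open>y^3 - 2 y^2 + 4 E y - 2 J^2\<close>, and \<open>y = a cos^2 \<theta> + b sin^2 \<theta>\<close> turns period and phase into complete
  elliptic integrals over \<open>[0, \<pi>/2]\<close>, of the first kind and of the third kind. Differentiating, and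
  discarding exact differentials, all four partial derivatives become combinations of
  \<open>A = \<integral> cos^2 \<theta> / (c - y)^(3/2) d\<theta>\<close> and \<open>B = \<integral> sin^2 \<theta> / (c - y)^(3/2) d\<theta>\<close> with
  coefficients rational in \<open>a\<close>, \<open>b\<close>, \<open>c\<close>, \<open>J\<close>. Then \<open>\<Delta>\<close> is an explicit quadratic form in \<open>A\<close> and \<open>B\<close>,
  positive because of the elementary inequality \<open>(c - b) B \<le> (c - a) A\<close>.
\<close>

section \<open>The roots of the cubic\<close>

text \<open>Two obstacles shape the argument. Period and phase are integrals with moving, singular
  end points, so they cannot be differentiated under the integral sign as they stand; over the fixed
  interval from 0 to pi/2 the integrand is smooth in the roots, and the roots, being simple, are
  differentiable in \<open>J\<close> and \<open>E\<close>. At \<open>J = 0\<close> the lowest root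
  is 0, the integrand of the third kind is singular, and formulas with \<open>a'/a\<close> lose
  their meaning. Therefore pi sgn J is itself written as a multiple of the integral of 1/y and
  subtracted under the integral, which leaves \<open>J\<close> times a continuous function. Since
  the renormalized phase vanishes for all \<open>E\<close> at \<open>J = 0\<close>, the determinant
  is there a product of two positive factors. For \<open>J\<close> nonzero, no integral of the third
  kind survives: its derivative contains it only with the logarithmic derivative of
  \<open>a*b*c = 2*J^2\<close> as factor, and the derivative of the prefactor \<open>J\<close>
  cancels that term. The mixed entries of the matrix are opposite, because period and phase are, up
  to sign, the partial derivatives of one action integral; so they contribute a square with a plus
  sign.\<close>

definition cubic :: "real \<Rightarrow> real \<Rightarrow> real \<Rightarrow> real"
  where "cubic u s y = y^3 - 2*y^2 + u*y - s"

text \<open>Encoded by Vieta's relations, because later identities use \<open>a + b + c = 2\<close>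
  and \<open>a*b*c = s\<close> directly; the strict order makes the triple unique. The intended
  values are \<open>u = 4*E\<close> and \<open>s = 2*J^2\<close>.\<close>

definition cubic_roots :: "real \<Rightarrow> real \<Rightarrow> real \<Rightarrow> real \<Rightarrow> real \<Rightarrow> bool"
  where "cubic_roots u s a b c \<longleftrightarrow>
    a < b \<and> b < c \<and> a + b + c = 2 \<and> a*b + b*c + c*a = u \<and> a*b*c = s"

lemma cubic_factor:
  assumes "cubic_roots u s a b c"
  shows "cubic u s y = (y - a) * (y - b) * (y - c)"
proof -
  have "2 = a + b + c" "u = a*b + b*c + c*a" "s = a*b*c"
    using assms by (auto simp: cubic_roots_def)
  then have "cubic u s y = y^3 - (a + b + c)*y^2 + (a*b + b*c + c*a)*y - a*b*c"
    unfolding cubic_def by metis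
  then show ?thesis by (simp add: algebra_simps power2_eq_square power3_eq_cube)
qed

lemma cubic_derivative_factor:
  assumes "cubic_roots u s a b c"
  shows "3 * y^2 - 4 * y + u = (y - a) * (y - b) + (y - b) * (y - c) + (y - a) * (y - c)"
proof -
  have "4 = 2 * (a + b + c)" "u = a*b + b*c + c*a"
    using assms by (auto simp: cubic_roots_def)
  then have "3 * y^2 - 4 * y + u = 3 * y^2 - 2 * (a + b + c) * y + (a*b + b*c + c*a)"
    by metis
  then show ?thesis by (simp add: algebra_simps power2_eq_square)
qed

lemma cubic_zero_iff:
  assumes "cubic_roots u s a b c"
  shows "cubic u s y = 0 \<longleftrightarrow> y = a \<or> y = b \<or> y = c"
  using cubic_factor[OF assms] by auto

text \<open>Divided differences: subtracting the equations of two distinct roots leaves a quadratic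
  relation, and subtracting two such relations gives the sum of the roots. The other two Vieta
  relations follow by back substitution.\<close>

lemma cubic_rootsI:
  assumes "a < b" "b < c" "cubic u s a = 0" "cubic u s b = 0" "cubic u s c = 0"
  shows "cubic_roots u s a b c"
proof -
  have 1: "(a - b) * (a^2 + a*b + b^2 - 2*(a + b) + u) = 0"
    using assms(3,4) unfolding cubic_def by algebra
  have 2: "(b - c) * (b^2 + b*c + c^2 - 2*(b + c) + u) = 0"
    using assms(4,5) unfolding cubic_def by algebra
  have 1: "a^2 + a*b + b^2 - 2*(a + b) + u = 0" using 1 assms(1) by simp
  have 2: "b^2 + b*c + c^2 - 2*(b + c) + u = 0" using 2 assms(2) by simp
  have "(a - c) * (a + b + c - 2) = 0" using 1 2 by algebra
  then have 3: "a + b + c = 2" using assms(1,2) by simp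
  have 4: "a*b + b*c + c*a = u" using 1 3 by algebra
  have "a^3 - (a + b + c)*a^2 + (a*b + b*c + c*a)*a - s = 0"
    using assms(3) by (simp add: 3 4 cubic_def)
  then have "a*b*c = s" by algebra
  then show ?thesis using assms 3 4 by (simp add: cubic_roots_def)
qed

lemma cubic_roots_unique:
  assumes "cubic_roots u s a b c" "cubic_roots u s a' b' c'"
  shows "a' = a \<and> b' = b \<and> c' = c"
proof -
  have "cubic u s a' = 0" "cubic u s b' = 0" "cubic u s c' = 0"
    using cubic_zero_iff[OF assms(2)] by auto
  then have "a' \<in> {a,b,c}" "b' \<in> {a,b,c}" "c' \<in> {a,b,c}"
    using cubic_zero_iff[OF assms(1)] by auto
  then show ?thesis using assms unfolding cubic_roots_def by auto
qed

section \<open>Dependence of the roots on the coefficients\<close>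

lemma cubic_IVT:
  assumes "l \<le> r" "cubic u s l * cubic u s r < 0"
  shows "\<exists>y. l < y \<and> y < r \<and> cubic u s y = 0"
proof -
  have c: "continuous_on {l..r} (cubic u s)"
    unfolding cubic_def by (intro continuous_intros)
  have "\<exists>y. l \<le> y \<and> y \<le> r \<and> cubic u s y = 0"
    using assms IVT'[of "cubic u s" l 0 r] IVT2'[of "cubic u s" r 0 l] c
    by (metis less_eq_real_def mult_less_0_iff)
  then obtain y where y: "l \<le> y" "y \<le> r" "cubic u s y = 0" by blast
  moreover have "y \<noteq> l" "y \<noteq> r" using y(3) assms(2) by auto
  ultimately show ?thesis by force
qed

text \<open>Simple roots are bracketed by strict sign changes, and the finitely many strict
  inequalities at the bracket ends persist under small changes of the coefficients.\<close>

lemma cubic_roots_near: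
  fixes u s :: "real \<Rightarrow> real"
  assumes r: "cubic_roots (u t0) (s t0) a0 b0 c0" and "isCont u t0" "isCont s t0" "0 < e"
  shows "\<forall>\<^sub>F t in nhds t0. \<exists>a b c. cubic_roots (u t) (s t) a b c
           \<and> \<bar>a - a0\<bar> < e \<and> \<bar>b - b0\<bar> < e \<and> \<bar>c - c0\<bar> < e"
proof -
  have ord: "a0 < b0" "b0 < c0" using r by (auto simp: cubic_roots_def)
  \<comment> \<open>Half of each gap is the largest radius for which neighbouring brackets do not
    overlap; so the three roots found come out in order.\<close>
  define d where "d = min e (min ((b0 - a0)/2) ((c0 - b0)/2))"
  have d: "0 < d" "d \<le> e" "d \<le> (b0 - a0)/2" "d \<le> (c0 - b0)/2"
    using ord assms(4) unfolding d_def min_def by auto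
  have cont: "((\<lambda>t. cubic (u t) (s t) y) \<longlongrightarrow> cubic (u t0) (s t0) y) (nhds t0)" for y
    using assms(2,3) unfolding cubic_def
    by (intro tendsto_intros) (auto simp: continuous_at tendsto_at_iff_tendsto_nhds)
  have neg: "\<forall>\<^sub>F t in nhds t0. cubic (u t) (s t) y < 0" if "cubic (u t0) (s t0) y < 0" for y
    using order_tendstoD(2)[OF cont that] .
  have pos: "\<forall>\<^sub>F t in nhds t0. 0 < cubic (u t) (s t) y" if "0 < cubic (u t0) (s t0) y" for y
    using order_tendstoD(1)[OF cont that] .
  note f = cubic_factor[OF r]
  have "cubic (u t0) (s t0) (a0 - d) < 0" "cubic (u t0) (s t0) (b0 + d) < 0"
      "cubic (u t0) (s t0) (c0 - d) < 0"
    and "0 < cubic (u t0) (s t0) (a0 + d)" "0 < cubic (u t0) (s t0) (b0 - d)"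
      "0 < cubic (u t0) (s t0) (c0 + d)"
    unfolding f using d ord by (auto simp: mult_less_0_iff zero_less_mult_iff)
  note this(1-3)[THEN neg] this(4-6)[THEN pos]
  then have "\<forall>\<^sub>F t in nhds t0. cubic (u t) (s t) (a0 - d) < 0 \<and> 0 < cubic (u t) (s t) (a0 + d)
    \<and> 0 < cubic (u t) (s t) (b0 - d) \<and> cubic (u t) (s t) (b0 + d) < 0
    \<and> cubic (u t) (s t) (c0 - d) < 0 \<and> 0 < cubic (u t) (s t) (c0 + d)"
    by (simp add: eventually_conj_iff)
  then show ?thesis
  proof eventually_elim
    case (elim t)
    obtain a where a: "a0 - d < a" "a < a0 + d" "cubic (u t) (s t) a = 0"
      using cubic_IVT[of "a0 - d" "a0 + d" "u t" "s t"] elim d(1) by (auto simp: mult_less_0_iff)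
    obtain b where b: "b0 - d < b" "b < b0 + d" "cubic (u t) (s t) b = 0"
      using cubic_IVT[of "b0 - d" "b0 + d" "u t" "s t"] elim d(1) by (auto simp: mult_less_0_iff)
    obtain c where c: "c0 - d < c" "c < c0 + d" "cubic (u t) (s t) c = 0"
      using cubic_IVT[of "c0 - d" "c0 + d" "u t" "s t"] elim d(1) by (auto simp: mult_less_0_iff)
    have "a < b" "b < c" using a b c d(3,4) by auto
    then have "cubic_roots (u t) (s t) a b c" using a b c by (intro cubic_rootsI)
    moreover have "\<bar>a - a0\<bar> < e" "\<bar>b - b0\<bar> < e" "\<bar>c - c0\<bar> < e" using a b c d(2) by auto
    ultimately show ?case by blast
  qed
qed

text \<open>Subtracting the equations of the two cubics gives a difference quotient for the root which
  needs only continuity of the root, so that no implicit function theorem is required.\<close>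

lemma cubic_root_derivative:
  fixes u s e :: "real \<Rightarrow> real"
  assumes u: "(u has_real_derivative u') (at t0)" and s: "(s has_real_derivative s') (at t0)"
    and z: "\<forall>\<^sub>F t in nhds t0. cubic (u t) (s t) (e t) = 0"
    and c: "isCont e t0"
    and n: "3 * (e t0)^2 - 4 * e t0 + u t0 \<noteq> 0"
  shows "(e has_real_derivative (s' - u' * e t0) / (3 * (e t0)^2 - 4 * e t0 + u t0)) (at t0)"
proof -
  \<comment> \<open>The divided difference, between \<open>e t\<close> and \<open>e t0\<close>, of
    the cubic with coefficients frozen at \<open>t0\<close>; its limit is the derivative of that
    cubic at \<open>e t0\<close>.\<close>
  define Q where "Q t = (e t)^2 + e t * e t0 + (e t0)^2 - 2 * (e t + e t0) + u t0" for t
  have et: "(e \<longlongrightarrow> e t0) (at t0)" using c by (simp add: continuous_at)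
  have "(Q \<longlongrightarrow> Q t0) (at t0)" unfolding Q_def using et by (intro tendsto_intros)
  moreover have Q0: "Q t0 = 3 * (e t0)^2 - 4 * e t0 + u t0"
    by (simp add: Q_def power2_eq_square)
  ultimately have Q: "(Q \<longlongrightarrow> 3 * (e t0)^2 - 4 * e t0 + u t0) (at t0)" by simp
  have 1: "((\<lambda>t. ((s t - s t0)/(t - t0) - (u t - u t0)/(t - t0) * e t) / Q t)
     \<longlongrightarrow> (s' - u' * e t0) / (3 * (e t0)^2 - 4 * e t0 + u t0)) (at t0)"
    using u s et Q n by (intro tendsto_intros) (auto simp: has_field_derivative_iff)
  have nz: "\<forall>\<^sub>F t in at t0. Q t \<noteq> 0" using Q n by (rule tendsto_imp_eventually_ne)
  have z0: "cubic (u t0) (s t0) (e t0) = 0" using z by (rule eventually_nhds_x_imp_x)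
  have z': "\<forall>\<^sub>F t in at t0. cubic (u t) (s t) (e t) = 0"
    using z by (simp add: eventually_at_filter eventually_mono)
  have ne: "\<forall>\<^sub>F t in at t0. t \<noteq> t0" by (simp add: eventually_at_filter)
  have "\<forall>\<^sub>F t in at t0. ((s t - s t0)/(t - t0) - (u t - u t0)/(t - t0) * e t) / Q t
       = (e t - e t0) / (t - t0)"
    using nz z' ne
  proof eventually_elim
    case (elim t)
    have "(e t - e t0) * Q t = (s t - s t0) - (u t - u t0) * e t"
      using elim(2) z0 unfolding cubic_def Q_def by algebra
    then have "(s t - s t0) / (t - t0) - (u t - u t0) / (t - t0) * e t = (e t - e t0) * Q t / (t - t0)"
      by (metis diff_divide_distrib times_divide_eq_left)
    then show ?case using elim(1) by simp
  qed
  then show ?thesis unfolding has_field_derivative_iff using 1 by (rule tendsto_cong[THEN iffD1])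
qed

text \<open>The roots are selected pointwise by choice; uniqueness of the ordered triple makes the
  selection agree with the nearby roots of \<open>cubic_roots_near\<close>, hence continuous.
  Derivatives are given on a whole ball, since differentiation under the integral needs them near
  \<open>t0\<close>.\<close>

lemma cubic_roots_path:
  fixes u s u' s' :: "real \<Rightarrow> real"
  assumes r: "cubic_roots (u t0) (s t0) a0 b0 c0"
    and u: "\<And>t. (u has_real_derivative u' t) (at t)" and s: "\<And>t. (s has_real_derivative s' t) (at t)"
  obtains d a b c where "0 < d" "a t0 = a0" "b t0 = b0" "c t0 = c0"
    "\<And>t. t \<in> ball t0 d \<Longrightarrow> cubic_roots (u t) (s t) (a t) (b t) (c t)"
    "\<And>t. t \<in> ball t0 d \<Longrightarrow>
      (a has_real_derivative (s' t - u' t * a t) / ((a t - b t) * (a t - c t))) (at t)"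
    "\<And>t. t \<in> ball t0 d \<Longrightarrow>
      (b has_real_derivative (s' t - u' t * b t) / ((b t - a t) * (b t - c t))) (at t)"
    "\<And>t. t \<in> ball t0 d \<Longrightarrow>
      (c has_real_derivative (s' t - u' t * c t) / ((c t - a t) * (c t - b t))) (at t)"
proof -
  have cu: "isCont u t" and cs: "isCont s t" for t using u s by (auto intro: DERIV_isCont)
  define R where "R t = (SOME (a,b,c). cubic_roots (u t) (s t) a b c)" for t
  define a b c where "a t = fst (R t)" and "b t = fst (snd (R t))" and "c t = snd (snd (R t))" for t
  have R: "cubic_roots (u t) (s t) (a t) (b t) (c t)" if "cubic_roots (u t) (s t) x y z" for t x y z
  proof -
    have "case R t of (a,b,c) \<Rightarrow> cubic_roots (u t) (s t) a b c"
      unfolding R_def by (rule someI[of _ "(x,y,z)"]) (use that in simp)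
    then show ?thesis by (simp add: a_def b_def c_def split_beta)
  qed
  from cubic_roots_near[of u t0 s, OF r cu cs, of 1]
  obtain d where d: "0 < d" "\<And>t. t \<in> ball t0 d \<Longrightarrow> \<exists>a b c. cubic_roots (u t) (s t) a b c"
    unfolding eventually_nhds_metric by (auto simp: dist_commute) blast
  have R': "cubic_roots (u t) (s t) (a t) (b t) (c t)" if "t \<in> ball t0 d" for t
    using d(2)[OF that] R by blast
  have near: "\<forall>\<^sub>F w in nhds t. \<bar>a w - a t\<bar> < e \<and> \<bar>b w - b t\<bar> < e \<and> \<bar>c w - c t\<bar> < e"
    if t: "t \<in> ball t0 d" and "0 < e" for t e
    using cubic_roots_near[of u t s, OF R'[OF t] cu cs \<open>0 < e\<close>]
  proof eventually_elim
    case (elim w)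
    then show ?case using R cubic_roots_unique by metis
  qed
  have cont: "isCont a t" "isCont b t" "isCont c t" if "t \<in> ball t0 d" for t
    unfolding continuous_at tendsto_at_iff_tendsto_nhds
    by (rule tendstoI, rule eventually_mono[OF near[OF that]], assumption, simp add: dist_real_def)+
  have z: "\<forall>\<^sub>F w in nhds t. cubic (u w) (s w) (a w) = 0"
     "\<forall>\<^sub>F w in nhds t. cubic (u w) (s w) (b w) = 0"
     "\<forall>\<^sub>F w in nhds t. cubic (u w) (s w) (c w) = 0" if "t \<in> ball t0 d" for t
    by (rule eventually_mono[OF eventually_nhds_in_open[OF open_ball that]],
        use R' cubic_zero_iff in blast)+
  \<comment> \<open>The derivative of the cubic at a root is the product of the differences to the
    other two, hence nonzero.\<close>
  have P: "3 * (a t)^2 - 4 * a t + u t = (a t - b t) * (a t - c t)"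
    "3 * (b t)^2 - 4 * b t + u t = (b t - a t) * (b t - c t)"
    "3 * (c t)^2 - 4 * c t + u t = (c t - a t) * (c t - b t)"
    "a t < b t" "b t < c t" if "t \<in> ball t0 d" for t
    using cubic_derivative_factor[OF R'[OF that]] R'[OF that] by (auto simp: cubic_roots_def)
  have t0: "t0 \<in> ball t0 d" using d by simp
  show ?thesis
  proof (rule that[of d a b c])
    show "0 < d" by fact
    show "a t0 = a0" "b t0 = b0" "c t0 = c0" using cubic_roots_unique[OF r R'[OF t0]] by auto
    fix t assume t: "t \<in> ball t0 d"
    show "cubic_roots (u t) (s t) (a t) (b t) (c t)" using R'[OF t] .
    show "(a has_real_derivative (s' t - u' t * a t) / ((a t - b t) * (a t - c t))) (at t)"
      using cubic_root_derivative[OF u s z(1)[OF t] cont(1)[OF t]] P[OF t] by simp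
    show "(b has_real_derivative (s' t - u' t * b t) / ((b t - a t) * (b t - c t))) (at t)"
      using cubic_root_derivative[OF u s z(2)[OF t] cont(2)[OF t]] P[OF t] by simp
    show "(c has_real_derivative (s' t - u' t * c t) / ((c t - a t) * (c t - b t))) (at t)"
      using cubic_root_derivative[OF u s z(3)[OF t] cont(3)[OF t]] P[OF t] by simp
  qed
qed

section \<open>The parameter domain\<close>

text \<open>Existence of a witness for \<open>SOME\<close>: between its critical points, plus and
  minus 1/sqrt 3, the function \<open>q * (1 - q^2)\<close> takes all values between its extrema,
  whose squares are 4/27.\<close>

lemma small_param:
  assumes "J^2 < 4/27"
  shows "J = small_param J * (1 - (small_param J)^2)" "(small_param J)^2 < 1/3"
proof -
  define m :: real where "m = 1 / sqrt 3"
  have m: "m^2 = 1/3" "0 < m" by (simp_all add: m_def power_divide)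
  have "\<bar>J\<bar>^2 < (2/3 * m)^2" using assms m(1) by (simp add: power_mult_distrib power_divide)
  then have J: "\<bar>J\<bar> < 2/3 * m" using m(2) by (meson less_eq_real_def mult_nonneg_nonneg power2_less_imp_less zero_le_divide_iff zero_le_numeral)
  have e: "m * (1 - m^2) = 2/3 * m" "(-m) * (1 - (-m)^2) = - (2/3 * m)" by (simp_all add: m(1))
  have "continuous_on {-m..m} (\<lambda>q. q * (1 - q^2))" by (intro continuous_intros)
  then obtain q where q: "-m \<le> q" "q \<le> m" "q * (1 - q^2) = J"
    using IVT'[of "\<lambda>q. q * (1 - q^2)" "-m" J m, unfolded e] J m(2) by fastforce
  have "q \<noteq> m" "q \<noteq> -m" using q(3) e J by (metis abs_minus_cancel abs_ge_self leD)+
  then have "\<bar>q\<bar> < m" using q by auto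
  then have "q^2 < 1/3" using m by (metis abs_ge_zero power2_abs power_strict_mono zero_less_numeral)
  then have "J = q * (1 - q^2) \<and> 0 \<le> q^2 \<and> q^2 < 1/3" using q by simp
  then have "J = small_param J * (1 - (small_param J)^2) \<and> 0 \<le> (small_param J)^2 \<and> (small_param J)^2 < 1/3"
    unfolding small_param_def by (rule someI)
  then show "J = small_param J * (1 - (small_param J)^2)" "(small_param J)^2 < 1/3" by auto
qed

text \<open>Same method on the outer branch: from 1/sqrt 3 to 1 the function falls from its maximum
  to 0, which reaches every admissible absolute value of \<open>J\<close>; oddness then supplies the
  sign.\<close>

lemma large_param:
  assumes "J^2 < 4/27"
  shows "J = large_param J * (1 - (large_param J)^2)" "1/3 < (large_param J)^2" "(large_param J)^2 \<le> 1"
proof -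
  define m :: real where "m = 1 / sqrt 3"
  have m: "m^2 = 1/3" "0 < m" "m < 1" by (simp_all add: m_def power_divide)
  have "\<bar>J\<bar>^2 < (2/3 * m)^2" using assms m(1) by (simp add: power_mult_distrib power_divide)
  then have J: "\<bar>J\<bar> < 2/3 * m" using m(2) by (meson less_eq_real_def mult_nonneg_nonneg power2_less_imp_less zero_le_divide_iff zero_le_numeral)
  have e: "m * (1 - m^2) = 2/3 * m" by (simp add: m(1))
  have "continuous_on {m..1} (\<lambda>q. q * (1 - q^2))" by (intro continuous_intros)
  then obtain q where q: "m \<le> q" "q \<le> 1" "q * (1 - q^2) = \<bar>J\<bar>"
    using IVT2'[of "\<lambda>q. q * (1 - q^2)" 1 "\<bar>J\<bar>" m] e J m by auto
  have "q \<noteq> m" using q(3) e J by force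
  then have "m^2 < q^2" "q^2 \<le> 1" using q m power_strict_mono[of m q 2] by (auto simp: power_le_one)
  moreover define p where "p = (if J < 0 then - q else q)"
  ultimately have "J = p * (1 - p^2) \<and> 1/3 < p^2 \<and> p^2 \<le> 1" using q m by auto
  then have "J = large_param J * (1 - (large_param J)^2) \<and> 1/3 < (large_param J)^2 \<and> (large_param J)^2 \<le> 1"
    unfolding large_param_def by (rule someI)
  then show "J = large_param J * (1 - (large_param J)^2)" "1/3 < (large_param J)^2" "(large_param J)^2 \<le> 1" by auto
qed

text \<open>The critical points of the potential lie at \<open>r^2 = 1 - Q^2\<close> and
  \<open>r^2 = 1 - q^2\<close>, with values \<open>E_minus\<close> and \<open>E_plus\<close>. So the
  two energy bounds are exactly the signs of the cubic at these points; for \<open>J\<close> nonzero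
  the signs at 0, \<open>1 - Q^2\<close>, \<open>1 - q^2\<close> and 3 alternate. In the proof
  \<open>q\<close> and \<open>Q\<close> denote the squares.\<close>

lemma param_domain_cubic_roots:
  assumes "(J, E) \<in> param_domain"
  shows "0 < E" "\<exists>a b c. cubic_roots (4*E) (2*J^2) a b c"
proof -
  have J: "J^2 < 4/27" and E: "E_minus J < E" "E < E_plus J"
    using assms by (auto simp: param_domain_def)
  define q Q where "q = (small_param J)^2" and "Q = (large_param J)^2"
  have q: "0 \<le> q" "q < 1/3" "2*J^2 = 2*q*(1-q)^2"
    using small_param[OF J] by (auto simp: q_def) (metis power_mult_distrib)
  have Q: "1/3 < Q" "Q \<le> 1" "2*J^2 = 2*Q*(1-Q)^2"
    using large_param[OF J] by (auto simp: Q_def) (metis power_mult_distrib)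
  have E': "(1-Q)*(1+3*Q) < 4*E" "4*E < (1-q)*(1+3*q)"
    using E by (auto simp: E_minus_def E_plus_def q_def Q_def)
  have "0 \<le> (1-Q)*(1+3*Q)" using Q by simp
  then show E0: "0 < E" using E' by linarith
  have "cubic ((1-q)*(1+3*q)) (2*q*(1-q)^2) (1-q) = 0"
    unfolding cubic_def by algebra
  then have "cubic (4*E) (2*J^2) (1-q) = (4*E - (1-q)*(1+3*q)) * (1-q)"
    unfolding cubic_def q(3) by (simp add: algebra_simps)
  then have neg: "cubic (4*E) (2*J^2) (1-q) < 0"
    using mult_neg_pos[of "4*E - (1-q)*(1+3*q)" "1-q"] E' q(1,2) by linarith
  have pos3: "cubic (4*E) (2*J^2) 3 > 0"
    using E0 J by (simp add: cubic_def)
  obtain c where c: "1-q < c" "cubic (4*E) (2*J^2) c = 0"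
    using cubic_IVT[of "1-q" 3 "4*E" "2*J^2"] neg pos3 q by (auto simp: mult_less_0_iff)
  show "\<exists>a b c. cubic_roots (4*E) (2*J^2) a b c"
  proof (cases "J = 0")
    \<comment> \<open>Now \<open>1 - Q\<close> is 0 and is itself a root, so the sign argument no
      longer separates \<open>a\<close> from \<open>b\<close>; the cubic is y times a quadratic,
      solved explicitly.\<close>
    case True
    then have "Q = 1" "q = 0" using q Q by auto
    have "0 < b \<and> b < 1 - q \<and> cubic (4*E) (2*J^2) b = 0" if "b = 1 - sqrt (1 - 4*E)" for b
    proof -
      have 1: "4*E < 1" using E' \<open>q = 0\<close> by simp
      then have "(sqrt (1-4*E))^2 = 1 - 4*E" by simp
      then have "b^2 - 2*b + 4*E = 0" unfolding that by (simp add: power2_diff)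
      then have "cubic (4*E) (2*J^2) b = 0" using True unfolding cubic_def by algebra
      moreover have "0 < b" "b < 1" using that 1 E0 by auto
      ultimately show ?thesis using \<open>q = 0\<close> by simp
    qed
    then obtain b where "0 < b \<and> b < 1 - q \<and> cubic (4*E) (2*J^2) b = 0" by blast
    then have "cubic_roots (4*E) (2*J^2) 0 b c"
      using c True by (intro cubic_rootsI) (auto simp: cubic_def)
    then show ?thesis by blast
  next
    case False
    then have Q1: "Q < 1" using Q by (cases "Q = 1") auto
    have "cubic ((1-Q)*(1+3*Q)) (2*Q*(1-Q)^2) (1-Q) = 0"
      unfolding cubic_def by algebra
    then have "cubic (4*E) (2*J^2) (1-Q) = (4*E - (1-Q)*(1+3*Q)) * (1-Q)"
      unfolding cubic_def Q(3) by (simp add: algebra_simps)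
    then have pos: "cubic (4*E) (2*J^2) (1-Q) > 0" using E' Q1 by simp
    have neg0: "cubic (4*E) (2*J^2) 0 < 0" using False by (simp add: cubic_def)
    obtain a where a: "a < 1-Q" "cubic (4*E) (2*J^2) a = 0"
      using cubic_IVT[of 0 "1-Q" "4*E" "2*J^2"] neg0 pos Q by (auto simp: mult_less_0_iff)
    obtain b where b: "1-Q < b" "b < 1-q" "cubic (4*E) (2*J^2) b = 0"
      using cubic_IVT[of "1-Q" "1-q" "4*E" "2*J^2"] neg pos q Q by (auto simp: mult_less_0_iff)
    have "cubic_roots (4*E) (2*J^2) a b c" using a b c by (intro cubic_rootsI) auto
    then show ?thesis by blast
  qed
qed

text \<open>At a negative argument no term of the cubic is positive and the leading one is negative,
  which excludes negative roots.\<close>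

lemma cubic_roots_bounds:
  assumes r: "cubic_roots u s a b c" and "0 < u" "0 \<le> s"
  shows "0 \<le> a" "0 < b" "0 < c" "s \<noteq> 0 \<Longrightarrow> 0 < a" "s = 0 \<Longrightarrow> a = 0"
proof -
  show a: "0 \<le> a"
  proof (rule ccontr)
    assume "\<not> 0 \<le> a"
    then have "a^3 < 0" "u * a < 0" "0 \<le> a^2" using assms by (auto simp: mult_pos_neg)
    then have "cubic u s a < 0" using assms unfolding cubic_def by linarith
    then show False using cubic_zero_iff[OF r, of a] by simp
  qed
  show b: "0 < b" and c: "0 < c" using a r by (auto simp: cubic_roots_def)
  show "s \<noteq> 0 \<Longrightarrow> 0 < a" using a r by (auto simp: cubic_roots_def less_le)
  show "s = 0 \<Longrightarrow> a = 0" using b c r by (auto simp: cubic_roots_def)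
qed

section \<open>Period and phase as elliptic integrals\<close>

text \<open>Used in two roles: with end points \<open>a\<close>, \<open>b\<close> it is the
  substituted variable y; with \<open>c - a\<close>, \<open>c - b\<close> it is
  \<open>c - y\<close>, because the weights sum to 1.\<close>

definition cos_sin_mean :: "real \<Rightarrow> real \<Rightarrow> real \<Rightarrow> real"
  where "cos_sin_mean a b \<theta> = a * (cos \<theta>)^2 + b * (sin \<theta>)^2"

lemma cos_sin_mean_affine:
  "cos_sin_mean a b \<theta> = a + (b - a) * (sin \<theta>)^2" "c - cos_sin_mean a b \<theta> = cos_sin_mean (c - a) (c - b) \<theta>"
  unfolding cos_sin_mean_def using sin_cos_squared_add[of \<theta>] by algebra+

lemma cos_sin_mean_bounds:
  assumes "a \<le> b" shows "a \<le> cos_sin_mean a b \<theta>" "cos_sin_mean a b \<theta> \<le> b"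
proof -
  have "(sin \<theta>)^2 \<le> 1" by (simp add: abs_square_le_1)
  then have "(b - a) * (sin \<theta>)^2 \<le> b - a" using assms by (simp add: mult_left_le)
  then show "a \<le> cos_sin_mean a b \<theta>" "cos_sin_mean a b \<theta> \<le> b"
    using assms by (auto simp: cos_sin_mean_affine)
qed

lemma cos_sin_mean_pos:
  assumes "0 < a" "0 < b" shows "0 < cos_sin_mean a b \<theta>"
  using assms cos_sin_mean_bounds(1)[of a b \<theta>] cos_sin_mean_affine(1)[of a b \<theta>]
    sin_cos_squared_add[of \<theta>] unfolding cos_sin_mean_def
  by (metis add_nonneg_pos add_pos_nonneg mult_nonneg_nonneg mult_pos_pos less_eq_real_def
      zero_le_power2 zero_less_one add.right_neutral less_irrefl)

lemma continuous_on_cos_sin_mean [continuous_intros]: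
  fixes a b t :: "'a::t2_space \<Rightarrow> real"
  assumes "continuous_on S a" "continuous_on S b" "continuous_on S t"
  shows "continuous_on S (\<lambda>x. cos_sin_mean (a x) (b x) (t x))"
  unfolding cos_sin_mean_def using assms by (intro continuous_intros)

text \<open>The substitution \<open>r^2 = a cos^2 \<theta> + b sin^2 \<theta>\<close> is carried out by exhibiting an antiderivative
  of the singular integrand; for the gauge integral no separate integrability argument is needed.\<close>

lemma has_integral_turning_points:
  assumes ab: "0 \<le> a" "a < b" "b < c" and h: "continuous_on {a..b} h"
    and g: "\<And>r. sqrt a < r \<Longrightarrow> r < sqrt b \<Longrightarrow>
       g r = sqrt 2 * h (r^2) * r / sqrt ((r^2 - a) * (b - r^2) * (c - r^2))"
  shows "(g has_integral sqrt 2 * integral {0..pi/2}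
      (\<lambda>\<theta>. h (cos_sin_mean a b \<theta>) / sqrt (cos_sin_mean (c - a) (c - b) \<theta>))) {sqrt a..sqrt b}"
proof -
  define k where "k \<theta> = h (cos_sin_mean a b \<theta>) / sqrt (cos_sin_mean (c - a) (c - b) \<theta>)" for \<theta>
  define H where "H \<theta> = integral {0..\<theta>} k" for \<theta>
  \<comment> \<open>The inverse of the substitution, read off from
    \<open>2 * r^2 = a + b - (b - a) * cos (2 * \<theta>)\<close>.\<close>
  define \<Theta> where "\<Theta> r = arccos ((a + b - 2 * r^2) / (b - a)) / 2" for r
  have bnd: "cos_sin_mean a b \<theta> \<in> {a..b}" for \<theta>
    using cos_sin_mean_bounds[of a b \<theta>] ab by auto
  have pos: "0 < cos_sin_mean (c - a) (c - b) \<theta>" for \<theta>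
    using ab by (intro cos_sin_mean_pos) auto
  have k: "continuous_on {0..pi/2} k"
    unfolding k_def using pos bnd
    by (intro continuous_intros continuous_on_compose2[OF h]) (auto simp: less_le)
  have H': "(H has_real_derivative k \<theta>) (at \<theta>)" if "0 < \<theta>" "\<theta> < pi/2" for \<theta>
    using integral_has_real_derivative[OF k, of \<theta>] that
    by (simp add: H_def[abs_def] at_within_interior[of \<theta> "{0..pi/2}"])
  have H: "continuous_on {0..pi/2} H"
    unfolding H_def by (intro indefinite_integral_continuous_1 integrable_continuous_real k)
  have r2: "a \<le> r^2" "r^2 \<le> b" if "sqrt a \<le> r" "r \<le> sqrt b" for r
    using that ab
    by (metis real_sqrt_ge_zero order.trans power_mono real_sqrt_pow2 less_eq_real_def)+
  have r2s: "a < r^2" "r^2 < b" "0 < r" if "sqrt a < r" "r < sqrt b" for r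
    using that ab
    using power_strict_mono[of "sqrt a" r 2] power_strict_mono[of r "sqrt b" 2]
      real_sqrt_ge_zero[of a] le_less_trans[of 0 "sqrt a" r] by auto
  have arg: "-1 \<le> (a + b - 2 * r^2) / (b - a)" "(a + b - 2 * r^2) / (b - a) \<le> 1"
    if "sqrt a \<le> r" "r \<le> sqrt b" for r
    using r2[OF that] ab by (auto simp: field_simps)
  have \<Theta>: "\<Theta> r \<in> {0..pi/2}" if "r \<in> {sqrt a..sqrt b}" for r
    using arccos_lbound[OF arg] arccos_ubound[OF arg] that by (auto simp: \<Theta>_def)
  have c\<Theta>: "continuous_on {sqrt a..sqrt b} \<Theta>"
    unfolding \<Theta>_def using ab arg by (intro continuous_intros) auto
  have mean: "cos_sin_mean a b (\<Theta> r) = r^2" if "sqrt a \<le> r" "r \<le> sqrt b" for r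
  proof -
    have "1 - 2 * (sin (\<Theta> r))^2 = (a + b - 2 * r^2) / (b - a)"
      using cos_double_sin[of "\<Theta> r"] arg[OF that] by (simp add: \<Theta>_def)
    then have "(b - a) * (1 - 2 * (sin (\<Theta> r))^2) = a + b - 2 * r^2"
      using ab by (simp add: field_simps)
    then show ?thesis unfolding cos_sin_mean_affine(1) by algebra
  qed
  have \<Theta>': "(\<Theta> has_real_derivative r / sqrt ((r^2 - a) * (b - r^2))) (at r)"
    and \<Theta>i: "0 < \<Theta> r" "\<Theta> r < pi/2" if r: "sqrt a < r" "r < sqrt b" for r
  proof -
    define x where "x = (a + b - 2 * r^2) / (b - a)"
    note r = r2s[OF r]
    have x: "-1 < x" "x < 1" using r ab by (auto simp: x_def field_simps)
    show "0 < \<Theta> r" "\<Theta> r < pi/2"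
      using arccos_lt_bounded[of x] x by (auto simp: \<Theta>_def x_def)
    have "1 - x^2 = 4 * ((r^2 - a) * (b - r^2)) / (b - a)^2"
      using ab by (simp add: x_def power_divide diff_divide_eq_iff) (simp add: power2_eq_square algebra_simps)
    then have "sqrt (1 - x^2) = 2 * sqrt ((r^2 - a) * (b - r^2)) / (b - a)"
      using ab by (simp add: real_sqrt_mult real_sqrt_divide)
    moreover have "(\<Theta> has_real_derivative inverse (- sqrt (1 - x^2)) * (- (4 * r) / (b - a)) / 2) (at r)"
    proof -
      have "((\<lambda>r. (a + b - 2 * r^2) / (b - a)) has_real_derivative - (4 * r) / (b - a)) (at r)"
        by (rule DERIV_cdivide) (auto intro!: derivative_eq_intros)
      from DERIV_chain2[OF DERIV_arccos this] show ?thesis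
        unfolding \<Theta>_def using x unfolding x_def by (intro DERIV_cdivide) simp
    qed
    ultimately show "(\<Theta> has_real_derivative r / sqrt ((r^2 - a) * (b - r^2))) (at r)"
      using ab r by (simp add: field_simps)
  qed
  \<comment> \<open>The antiderivative is continuous up to the end points but differentiated only
    inside, so the values that \<open>1 / 0 = 0\<close> produces at the turning points never
    enter.\<close>
  have "(g has_integral sqrt 2 * H (\<Theta> (sqrt b)) - sqrt 2 * H (\<Theta> (sqrt a))) {sqrt a..sqrt b}"
  proof (rule fundamental_theorem_of_calculus_interior)
    show "sqrt a \<le> sqrt b" using ab by simp
    show "continuous_on {sqrt a..sqrt b} (\<lambda>r. sqrt 2 * H (\<Theta> r))"
      using \<Theta> by (intro continuous_intros continuous_on_compose2[OF H c\<Theta>]) auto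
    fix r assume "r \<in> {sqrt a<..<sqrt b}"
    then have r: "sqrt a < r" "r < sqrt b" by auto
    have "((\<lambda>r. sqrt 2 * H (\<Theta> r)) has_real_derivative
        sqrt 2 * (k (\<Theta> r) * (r / sqrt ((r^2 - a) * (b - r^2))))) (at r)"
      by (intro DERIV_cmult DERIV_chain2[OF H'[OF \<Theta>i[OF r]] \<Theta>'[OF r]])
    moreover have "k (\<Theta> r) = h (r^2) / sqrt (c - r^2)"
      using mean[of r] r by (simp add: k_def cos_sin_mean_affine(2)[symmetric])
    ultimately have "((\<lambda>r. sqrt 2 * H (\<Theta> r)) has_real_derivative g r) (at r)"
      using g[OF r] by (simp add: real_sqrt_mult mult_ac)
    then show "((\<lambda>r. sqrt 2 * H (\<Theta> r)) has_vector_derivative g r) (at r)"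
      by (simp add: has_real_derivative_iff_has_vector_derivative)
  qed
  moreover have "\<Theta> (sqrt a) = 0" "\<Theta> (sqrt b) = pi/2"
  proof -
    have "(a + b - 2 * a) / (b - a) = 1" "(a + b - 2 * b) / (b - a) = -1"
      using ab by (auto simp: field_simps)
    then show "\<Theta> (sqrt a) = 0" "\<Theta> (sqrt b) = pi/2" using ab by (simp_all add: \<Theta>_def)
  qed
  ultimately have "(g has_integral sqrt 2 * integral {0..pi/2} k) {sqrt a..sqrt b}"
    by (simp add: H_def)
  then show ?thesis unfolding k_def[abs_def] .
qed

text \<open>Multiplication by \<open>2 * x^2\<close> turns the left-hand side into the cubic at
  \<open>x^2\<close>. Two factors are reversed, so that all three are positive between the first two
  turning points.\<close>

lemma eff_potential_factor:
  assumes r: "cubic_roots (4*E) (2*J^2) a b c" and "0 < x"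
  shows "2 * (E - eff_potential J x) = (x^2 - a) * (b - x^2) * (c - x^2) / (2 * x^2)"
proof -
  have "2 * x^2 * (2 * (E - eff_potential J x)) = cubic (4*E) (2*J^2) (x^2)"
    using assms(2) by (simp add: eff_potential_def cubic_def field_simps)
  also have "\<dots> = (x^2 - a) * (b - x^2) * (c - x^2)"
    unfolding cubic_factor[OF r] by algebra
  finally show ?thesis using assms(2) by (simp add: field_simps)
qed

lemma inverse_sqrt_eff_potential:
  assumes r: "cubic_roots (4*E) (2*J^2) a b c" and "0 < x"
  shows "1 / sqrt (2 * (E - eff_potential J x))
    = sqrt 2 * x / sqrt ((x^2 - a) * (b - x^2) * (c - x^2))"
  unfolding eff_potential_factor[OF assms] using assms(2)
  by (simp add: real_sqrt_divide real_sqrt_mult)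

text \<open>For \<open>a = 0\<close> the root 0 would drop out of \<open>positive_roots\<close> and
  shift the numbering; this is the reason for \<open>0 < a\<close>.\<close>

lemma turning_points:
  assumes r: "cubic_roots (4*E) (2*J^2) a b c" and "0 < a"
  shows "r1 J E = sqrt a" "r2 J E = sqrt b"
proof -
  have ord: "a < b" "b < c" using r by (auto simp: cubic_roots_def)
  have "0 < x \<and> E - eff_potential J x = 0 \<longleftrightarrow> x = sqrt a \<or> x = sqrt b \<or> x = sqrt c" for x
  proof (cases "0 < x")
    case True
    have "E - eff_potential J x = 0 \<longleftrightarrow> x^2 = a \<or> x^2 = b \<or> x^2 = c"
      using eff_potential_factor[OF r True] True by auto
    then show ?thesis using True ord \<open>0 < a\<close> by auto
  next
    case False
    then show ?thesis using ord \<open>0 < a\<close> by auto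
  qed
  then have "positive_roots J E = {sqrt a, sqrt b, sqrt c}"
    by (auto simp: positive_roots_def)
  then show "r1 J E = sqrt a" "r2 J E = sqrt b"
    using ord by (simp_all add: turning_point_def)
qed

lemma period_eq:
  assumes r: "cubic_roots (4*E) (2*J^2) a b c" and E: "0 < E"
  shows "period J E = 2 * sqrt 2 * integral {0..pi/2} (\<lambda>\<theta>. 1 / sqrt (cos_sin_mean (c - a) (c - b) \<theta>))"
proof -
  note bnd = cubic_roots_bounds[OF r]
  have a: "0 \<le> a" "a < b" "b < c" using bnd E r by (auto simp: cubic_roots_def)
  have I: "integral {sqrt a..sqrt b} (\<lambda>r. 1 / sqrt (2 * (E - eff_potential J r)))
    = sqrt 2 * integral {0..pi/2} (\<lambda>\<theta>. 1 / sqrt (cos_sin_mean (c - a) (c - b) \<theta>))"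
    by (intro integral_unique has_integral_turning_points a continuous_intros)
       (simp only: inverse_sqrt_eff_potential[OF r le_less_trans[OF real_sqrt_ge_zero[OF a(1)]]] mult_1_right)
  show ?thesis
  proof (cases "J = 0")
    case True
    \<comment> \<open>With \<open>a = 0\<close>, \<open>b\<close> and \<open>c\<close> are the roots
      of \<open>y^2 - 2*y + 4*E\<close>; the smaller one is the square of the upper limit that
      \<open>period\<close> uses at \<open>J = 0\<close>.\<close>
    then have "a = 0" using bnd E by simp
    then have "b + c = 2" "b * c = 4 * E" using r by (auto simp: cubic_roots_def)
    then have "2 - b = c" by simp
    moreover have "(1 - b)^2 = 1 - b * (2 - b)" by (simp add: power2_eq_square algebra_simps)
    ultimately have "(1 - b)^2 = 1 - b * c" by metis
    then have "(1 - b)^2 = 1 - 4*E" using \<open>b * c = 4 * E\<close> by simp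
    moreover have "b < 1" using \<open>b + c = 2\<close> a by simp
    ultimately have "sqrt (1 - 4*E) = 1 - b" by (metis diff_ge_0_iff_ge less_eq_real_def real_sqrt_unique)
    then show ?thesis using I True \<open>a = 0\<close> by (simp add: period_def)
  next
    case False
    then have "0 < a" using bnd E by simp
    then show ?thesis using I False turning_points[OF r] by (simp add: period_def)
  qed
qed

lemma phase_eq:
  assumes r: "cubic_roots (4*E) (2*J^2) a b c" and E: "0 < E" and J: "J \<noteq> 0"
  shows "phase J E = 2 * sqrt 2 * J * integral {0..pi/2}
     (\<lambda>\<theta>. 1 / (cos_sin_mean a b \<theta> * sqrt (cos_sin_mean (c - a) (c - b) \<theta>)))"
proof -
  note bnd = cubic_roots_bounds[OF r]
  have a: "0 < a" "0 \<le> a" "a < b" "b < c" using bnd E J r by (auto simp: cubic_roots_def)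
  have "integral {sqrt a..sqrt b} (\<lambda>r. J / r^2 * (1 / sqrt (2 * (E - eff_potential J r))))
    = sqrt 2 * integral {0..pi/2} (\<lambda>\<theta>. J / cos_sin_mean a b \<theta> / sqrt (cos_sin_mean (c - a) (c - b) \<theta>))"
    by (intro integral_unique has_integral_turning_points[where h = "\<lambda>y. J / y"] a continuous_intros)
       (use a in \<open>auto simp only: inverse_sqrt_eff_potential[OF r le_less_trans[OF real_sqrt_ge_zero[OF a(2)]]]
          atLeastAtMost_iff times_divide_eq_right times_divide_eq_left mult_ac\<close>)
  also have "(\<lambda>\<theta>. J / cos_sin_mean a b \<theta> / sqrt (cos_sin_mean (c - a) (c - b) \<theta>))
    = (\<lambda>\<theta>. J * (1 / (cos_sin_mean a b \<theta> * sqrt (cos_sin_mean (c - a) (c - b) \<theta>))))"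
    by simp
  finally show ?thesis
    unfolding phase_def turning_points[OF r a(1)] integral_mult_right by (simp only: mult_ac)
qed

section \<open>Integrals of the second kind\<close>

text \<open>Together with \<open>sin_integral\<close>, -2 times the partial derivatives in
  \<open>p\<close> and \<open>q\<close> of the complete integral of the first kind.\<close>

definition cos_integral :: "real \<Rightarrow> real \<Rightarrow> real"
  where "cos_integral p q = integral {0..pi/2} (\<lambda>\<theta>. (cos \<theta>)^2 / (sqrt (cos_sin_mean p q \<theta>))^3)"

definition sin_integral :: "real \<Rightarrow> real \<Rightarrow> real"
  where "sin_integral p q = integral {0..pi/2} (\<lambda>\<theta>. (sin \<theta>)^2 / (sqrt (cos_sin_mean p q \<theta>))^3)"

lemma cos_sin_mean_nonzero:
  assumes "0 < p" "0 < q" shows "cos_sin_mean p q \<theta> \<noteq> 0"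
  using cos_sin_mean_pos[OF assms, of \<theta>] by simp

lemma cos_sin_integral_has_integral:
  assumes "0 < p" "0 < q"
  shows "((\<lambda>\<theta>. (cos \<theta>)^2 / (sqrt (cos_sin_mean p q \<theta>))^3) has_integral cos_integral p q) {0..pi/2}"
    "((\<lambda>\<theta>. (sin \<theta>)^2 / (sqrt (cos_sin_mean p q \<theta>))^3) has_integral sin_integral p q) {0..pi/2}"
  unfolding cos_integral_def sin_integral_def
  by (intro integrable_integral integrable_continuous_real continuous_intros;
      simp add: cos_sin_mean_nonzero[OF assms])+

lemma cos_sin_integral_pos:
  assumes "0 < p" "0 < q"
  shows "0 < cos_integral p q" "0 < sin_integral p q"
proof -
  have pos: "0 < integral {0..pi/2} f"
    if "continuous_on {0..pi/2} f" "\<And>x. 0 \<le> f x" "y \<in> {0..pi/2}" "f y \<noteq> 0" for f :: "real \<Rightarrow> real" and y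
    using integral_eq_0_iff[of 0 "pi/2" f] integral_nonneg[OF integrable_continuous_real[OF that(1)]] that
    by force
  have nn: "0 \<le> cos_sin_mean p q \<theta>" for \<theta> using cos_sin_mean_pos[OF assms, of \<theta>] by simp
  show "0 < cos_integral p q" unfolding cos_integral_def
    by (rule pos[of _ 0]; (intro continuous_intros)?)
       (use assms nn cos_sin_mean_nonzero[OF assms] in auto)
  show "0 < sin_integral p q" unfolding sin_integral_def
    by (rule pos[of _ "pi/2"]; (intro continuous_intros)?)
       (use assms nn cos_sin_mean_nonzero[OF assms] in auto)
qed

lemma cos_sin_mean_derivative:
  "(cos_sin_mean p q has_real_derivative 2 * (q - p) * sin \<theta> * cos \<theta>) (at \<theta>)"
  unfolding cos_sin_mean_def [abs_def]
  by (auto intro!: derivative_eq_intros simp: algebra_simps)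

lemma DERIV_sqrt_compose:
  assumes "(g has_real_derivative g') (at t)" "0 < g t"
  shows "((\<lambda>t. sqrt (g t)) has_real_derivative inverse (sqrt (g t)) / 2 * g') (at t)"
  by (rule DERIV_chain2[OF DERIV_real_sqrt]) (use assms in auto)

lemma sqrt_cos_sin_mean_derivative:
  assumes "0 < p" "0 < q"
  shows "((\<lambda>\<theta>. sqrt (cos_sin_mean p q \<theta>)) has_real_derivative
    (q - p) * sin \<theta> * cos \<theta> / sqrt (cos_sin_mean p q \<theta>)) (at \<theta>)"
proof -
  have "((\<lambda>\<theta>. sqrt (cos_sin_mean p q \<theta>)) has_real_derivative
      inverse (sqrt (cos_sin_mean p q \<theta>)) / 2 * (2 * (q - p) * sin \<theta> * cos \<theta>)) (at \<theta>)"
    by (rule DERIV_sqrt_compose[OF cos_sin_mean_derivative cos_sin_mean_pos[OF assms]])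
  moreover have "inverse D / 2 * (2 * x * s * c) = x * s * c / D" for D x s c :: real
    by (simp add: field_simps)
  ultimately show ?thesis by (simp only:)
qed

text \<open>The difference of the two sides is, up to the exact differential of
  \<open>sin \<theta> cos \<theta> / sqrt (p cos^2 \<theta> + q sin^2 \<theta>)\<close>, the integral of a nonnegative function.\<close>

lemma sin_integral_le_cos_integral:
  assumes "0 < q" "q \<le> p"
  shows "q * sin_integral p q \<le> p * cos_integral p q"
proof -
  have p: "0 < p" using assms by simp
  define D where "D \<theta> = sqrt (cos_sin_mean p q \<theta>)" for \<theta>
  have D: "0 < D \<theta>" "(D \<theta>)^2 = p * (cos \<theta>)^2 + q * (sin \<theta>)^2" for \<theta>
    using cos_sin_mean_pos[OF p assms(1), of \<theta>] by (auto simp: D_def cos_sin_mean_def)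
  \<comment> \<open>The derivative of \<open>sin \<theta> * cos \<theta> / D \<theta>\<close>, whose
    boundary values vanish, so that \<open>f\<close> integrates to 0.\<close>
  define f where "f \<theta> = (p * (cos \<theta>)^2 * (cos \<theta>)^2 - q * (sin \<theta>)^2 * (sin \<theta>)^2) / (D \<theta>)^3" for \<theta>
  have "((\<lambda>\<theta>. sin \<theta> * cos \<theta> / D \<theta>) has_real_derivative f \<theta>) (at \<theta>)" for \<theta>
  proof -
    have "((\<lambda>\<theta>. sin \<theta> * cos \<theta> / D \<theta>) has_real_derivative
       ((cos \<theta> * cos \<theta> + (- sin \<theta>) * sin \<theta>) * D \<theta> - sin \<theta> * cos \<theta> * ((q - p) * sin \<theta> * cos \<theta> / D \<theta>))
         / (D \<theta> * D \<theta>)) (at \<theta>)"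
      using sqrt_cos_sin_mean_derivative[OF p assms(1), of \<theta>, folded D_def] D(1)[of \<theta>]
      by (intro DERIV_divide DERIV_mult DERIV_sin DERIV_cos) auto
    also have "((cos \<theta> * cos \<theta> + (- sin \<theta>) * sin \<theta>) * D \<theta> - sin \<theta> * cos \<theta> * ((q - p) * sin \<theta> * cos \<theta> / D \<theta>))
         / (D \<theta> * D \<theta>)
      = (((cos \<theta>)^2 - (sin \<theta>)^2) * (D \<theta>)^2 - (q - p) * (sin \<theta>)^2 * (cos \<theta>)^2) / (D \<theta>)^3"
      using D(1)[of \<theta>] by (simp add: field_simps power2_eq_square power3_eq_cube)
    also have "\<dots> = f \<theta>"
      unfolding f_def D(2) by (simp add: algebra_simps)
    finally show ?thesis .
  qed
  then have "(f has_integral sin (pi/2) * cos (pi/2) / D (pi/2) - sin 0 * cos 0 / D 0) {0..pi/2}"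
    by (intro fundamental_theorem_of_calculus)
       (auto simp: has_real_derivative_iff_has_vector_derivative[symmetric] intro: has_field_derivative_at_within)
  then have f: "(f has_integral 0) {0..pi/2}" by simp
  have I: "((\<lambda>\<theta>. p * ((cos \<theta>)^2 / (D \<theta>)^3) - q * ((sin \<theta>)^2 / (D \<theta>)^3) - f \<theta>) has_integral
      (p * cos_integral p q - q * sin_integral p q - 0)) {0..pi/2}"
    using cos_sin_integral_has_integral[OF p assms(1)] f unfolding D_def
    by (intro has_integral_diff has_integral_mult_right)
  \<comment> \<open>Subtracting \<open>f\<close> leaves
    \<open>p * cos^2 * (1 - cos^2) - q * sin^2 * (1 - sin^2)\<close> as numerator, where both
    products equal \<open>sin^2 * cos^2\<close>.\<close>
  have eq: "p * ((cos \<theta>)^2 / (D \<theta>)^3) - q * ((sin \<theta>)^2 / (D \<theta>)^3) - f \<theta>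
     = (p - q) * (sin \<theta>)^2 * (cos \<theta>)^2 / (D \<theta>)^3" for \<theta>
  proof -
    have "p * (cos \<theta>)^2 - q * (sin \<theta>)^2
       - (p * (cos \<theta>)^2 * (cos \<theta>)^2 - q * (sin \<theta>)^2 * (sin \<theta>)^2) = (p - q) * (sin \<theta>)^2 * (cos \<theta>)^2"
      using sin_cos_squared_add[of \<theta>] by algebra
    then show ?thesis
      unfolding f_def by (simp add: diff_divide_distrib[symmetric])
  qed
  have "0 \<le> p * cos_integral p q - q * sin_integral p q - 0"
  proof (rule has_integral_nonneg[OF I])
    fix \<theta>
    show "0 \<le> p * ((cos \<theta>)^2 / (D \<theta>)^3) - q * ((sin \<theta>)^2 / (D \<theta>)^3) - f \<theta>"
      unfolding eq[of \<theta>] using D(1)[of \<theta>] assms by simp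
  qed
  then show ?thesis by simp
qed

section \<open>Differentiation under the integral sign\<close>

lemma continuous_on_fst_compose:
  "continuous_on U f \<Longrightarrow> continuous_on (U \<times> B) (\<lambda>x. f (fst x))"
  by (rule continuous_on_compose2[of U f _ fst]) (auto intro: continuous_intros)

text \<open>A ball is convex, as the general Leibniz rule demands of the parameter set, and open, so
  the derivative within it is a full derivative.\<close>

lemma leibniz_rule_open_interval:
  fixes f :: "real \<Rightarrow> real \<Rightarrow> real"
  assumes "\<And>t \<theta>. t \<in> ball t0 d \<Longrightarrow> ((\<lambda>t. f t \<theta>) has_real_derivative f' t \<theta>) (at t)"
    and "\<And>t. t \<in> ball t0 d \<Longrightarrow> f t integrable_on {l..r}"
    and "continuous_on (ball t0 d \<times> {l..r}) (\<lambda>(t, \<theta>). f' t \<theta>)" and "0 < d"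
  shows "((\<lambda>t. integral {l..r} (f t)) has_real_derivative integral {l..r} (f' t0)) (at t0)"
proof -
  have "((\<lambda>t. integral (cbox l r) (f t)) has_real_derivative integral (cbox l r) (f' t0)) (at t0 within ball t0 d)"
    using assms by (intro leibniz_rule_field_derivative) (auto intro: has_field_derivative_at_within)
  then show ?thesis using assms(4) by (simp add: at_within_open[of t0 "ball t0 d"])
qed

lemma DERIV_inverse_sqrt_compose:
  assumes "(g has_real_derivative g') (at t)" "0 < g t"
  shows "((\<lambda>t. 1 / sqrt (g t)) has_real_derivative - (g' / (sqrt (g t))^3) / 2) (at t)"
proof -
  have "((\<lambda>t. inverse (sqrt (g t))) has_real_derivative
      - (inverse (sqrt (g t)) * (inverse (sqrt (g t)) / 2 * g') * inverse (sqrt (g t)))) (at t)"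
    using assms by (intro DERIV_inverse' DERIV_sqrt_compose) auto
  moreover have "- (inverse D * (inverse D / 2 * g') * inverse D) = - (g' / D^3) / 2" for D :: real
    by (simp add: field_simps power3_eq_cube)
  ultimately show ?thesis by (simp add: inverse_eq_divide[symmetric])
qed

lemma first_kind_derivative:
  fixes p q p' q' :: "real \<Rightarrow> real"
  assumes d: "0 < d"
    and p: "\<And>t. t \<in> ball t0 d \<Longrightarrow> (p has_real_derivative p' t) (at t)"
    and q: "\<And>t. t \<in> ball t0 d \<Longrightarrow> (q has_real_derivative q' t) (at t)"
    and p': "continuous_on (ball t0 d) p'" and q': "continuous_on (ball t0 d) q'"
    and pos: "\<And>t. t \<in> ball t0 d \<Longrightarrow> 0 < p t \<and> 0 < q t"
  shows "((\<lambda>t. integral {0..pi/2} (\<lambda>\<theta>. 1 / sqrt (cos_sin_mean (p t) (q t) \<theta>))) has_real_derivative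
    - (p' t0 * cos_integral (p t0) (q t0) + q' t0 * sin_integral (p t0) (q t0)) / 2) (at t0)"
proof -
  define f' where "f' t \<theta> = - (cos_sin_mean (p' t) (q' t) \<theta> / (sqrt (cos_sin_mean (p t) (q t) \<theta>))^3) / 2" for t \<theta>
  have m: "0 < cos_sin_mean (p t) (q t) \<theta>" if "t \<in> ball t0 d" for t \<theta>
    using pos[OF that] by (intro cos_sin_mean_pos) auto
  then have nz: "cos_sin_mean (p t) (q t) \<theta> \<noteq> 0" if "t \<in> ball t0 d" for t \<theta>
    using that by (metis less_irrefl)
  have pc: "continuous_on (ball t0 d) p" and qc: "continuous_on (ball t0 d) q"
    by (rule DERIV_continuous_on, erule has_field_derivative_at_within[OF p] has_field_derivative_at_within[OF q])+
  have "((\<lambda>t. integral {0..pi/2} (\<lambda>\<theta>. 1 / sqrt (cos_sin_mean (p t) (q t) \<theta>))) has_real_derivative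
     integral {0..pi/2} (f' t0)) (at t0)"
  proof (rule leibniz_rule_open_interval[OF _ _ _ d])
    fix t \<theta> assume t: "t \<in> ball t0 d"
    show "(\<lambda>\<theta>. 1 / sqrt (cos_sin_mean (p t) (q t) \<theta>)) integrable_on {0..pi/2}"
      using nz[OF t] by (intro integrable_continuous_real continuous_intros) simp
    have "((\<lambda>t. cos_sin_mean (p t) (q t) \<theta>) has_real_derivative cos_sin_mean (p' t) (q' t) \<theta>) (at t)"
      unfolding cos_sin_mean_def using p[OF t] q[OF t] by (auto intro!: derivative_eq_intros)
    then show "((\<lambda>t. 1 / sqrt (cos_sin_mean (p t) (q t) \<theta>)) has_real_derivative f' t \<theta>) (at t)"
      unfolding f'_def using m[OF t] by (rule DERIV_inverse_sqrt_compose)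
  next
    show "continuous_on (ball t0 d \<times> {0..pi/2}) (\<lambda>(t, \<theta>). f' t \<theta>)"
      unfolding f'_def split_beta
      by (intro continuous_intros pc[THEN continuous_on_fst_compose] qc[THEN continuous_on_fst_compose]
          p'[THEN continuous_on_fst_compose] q'[THEN continuous_on_fst_compose]) (simp_all add: nz mem_Times_iff del: mem_ball)
  qed
  moreover have "(f' t0 has_integral - (p' t0 * cos_integral (p t0) (q t0) + q' t0 * sin_integral (p t0) (q t0)) / 2) {0..pi/2}"
  proof -
    have "((\<lambda>\<theta>. - (p' t0 * ((cos \<theta>)^2 / (sqrt (cos_sin_mean (p t0) (q t0) \<theta>))^3)
        + q' t0 * ((sin \<theta>)^2 / (sqrt (cos_sin_mean (p t0) (q t0) \<theta>))^3)) / 2) has_integral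
        - (p' t0 * cos_integral (p t0) (q t0) + q' t0 * sin_integral (p t0) (q t0)) / 2) {0..pi/2}"
      using pos[of t0] d
      by (intro has_integral_divide has_integral_neg has_integral_add has_integral_mult_right
          cos_sin_integral_has_integral) auto
    moreover have "f' t0 = (\<lambda>\<theta>. - (p' t0 * ((cos \<theta>)^2 / (sqrt (cos_sin_mean (p t0) (q t0) \<theta>))^3)
        + q' t0 * ((sin \<theta>)^2 / (sqrt (cos_sin_mean (p t0) (q t0) \<theta>))^3)) / 2)"
      unfolding f'_def[abs_def] cos_sin_mean_def[of "p' t0"]
      by (intro ext) (simp only: add_divide_distrib times_divide_eq_right)
    ultimately show ?thesis by (simp only:)
  qed
  ultimately show ?thesis by (simp add: integral_unique)
qed

section \<open>The integral of the third kind and the renormalized phase\<close>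

text \<open>The reduction to integrals of the second kind, pointwise in the angle: \<open>C\<close>
  and \<open>S\<close> stand for the squares of cosine and sine, \<open>D\<close> for
  \<open>sqrt (c - y)\<close>, \<open>N\<close> for the exact differential. Both sides are linear in
  \<open>a'\<close>, \<open>b'\<close>, \<open>c'\<close>, so the three coefficients are compared
  separately; each comparison is polynomial after clearing denominators.\<close>

lemma third_kind_integrand_identity:
  fixes a b c a' b' c' y D C S :: real
  assumes nz: "a \<noteq> 0" "b \<noteq> 0" "c \<noteq> 0" "y \<noteq> 0" "D \<noteq> 0"
    and D: "D^2 = c - y" and y: "y = a * C + b * S" and CS: "C + S = 1"
    and N: "N = ((C - S) * y * D^2 - 2 * (b - a) * S * C * D^2 + (b - a) * S * C * y) / (y^2 * D^3)"
  shows "- (a' * C + b' * S) / (y^2 * D) - (c' - (a' * C + b' * S)) / (2 * y * D^3)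
    = (a'/a - c'/c) / 2 * (C / D^3) + (b'/b - c'/c) / 2 * (S / D^3)
      - (a'/a + b'/b + c'/c) / 2 * (1 / (y * D)) + (b'/b - a'/a) / 2 * N"
proof -
  define K where "K = (C - S) * y * D^2 - 2 * (b - a) * S * C * D^2 + (b - a) * S * C * y"
  have N: "N = K / (y^2 * D^3)" unfolding N K_def ..
  have l: "- U / (y^2 * D) + U / (2 * y * D^3) = (U * y - 2 * U * D^2) / (y^2 * D^3) / 2" for U
    using nz by (simp add: divide_simps power2_eq_square power3_eq_cube)
  have rh: "U / D^3 - 1 / (y * D) = (U * y^2 - y * D^2) / (y^2 * D^3)" for U
    using nz by (simp add: divide_simps power2_eq_square power3_eq_cube)
      (simp add: algebra_simps)
  have A: "- C / (y^2 * D) + C / (2 * y * D^3) = (C / D^3 - 1 / (y * D) - N) / (2 * a)"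
  proof -
    have "a * (C * y - 2 * C * D^2) = C * y^2 - y * D^2 - K"
      unfolding K_def D using y CS by algebra
    then have "C * y - 2 * C * D^2 = (C * y^2 - y * D^2 - K) / a" using nz by (simp add: field_simps)
    then show ?thesis unfolding l rh N by (simp add: diff_divide_distrib[symmetric] mult_ac)
  qed
  have B: "- S / (y^2 * D) + S / (2 * y * D^3) = (S / D^3 - 1 / (y * D) + N) / (2 * b)"
  proof -
    have "b * (S * y - 2 * S * D^2) = S * y^2 - y * D^2 + K"
      unfolding K_def D using y CS by algebra
    then have "S * y - 2 * S * D^2 = (S * y^2 - y * D^2 + K) / b" using nz by (simp add: field_simps)
    then show ?thesis unfolding l rh N by (simp add: add_divide_distrib[symmetric] mult_ac)
  qed
  have G: "1 / (2 * y * D^3) = ((C + S) / D^3 + 1 / (y * D)) / (2 * c)"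
  proof -
    have c: "c = y + D^2" using D by simp
    have "1 / D^3 + 1 / (y * D) = c / (y * D^3)"
      using nz by (simp add: c divide_simps power2_eq_square power3_eq_cube)
    then show ?thesis using nz by (simp add: CS)
  qed
  have "- (a' * C + b' * S) / (y^2 * D) - (c' - (a' * C + b' * S)) / (2 * y * D^3)
    = a' * (- C / (y^2 * D) + C / (2 * y * D^3)) + b' * (- S / (y^2 * D) + S / (2 * y * D^3))
      - c' * (1 / (2 * y * D^3))"
    by (simp add: diff_divide_distrib add_divide_distrib algebra_simps)
  also have "\<dots> = a' * ((C / D^3 - 1 / (y * D) - N) / (2 * a)) + b' * ((S / D^3 - 1 / (y * D) + N) / (2 * b))
      - c' * (((C + S) / D^3 + 1 / (y * D)) / (2 * c))"
    unfolding A B G ..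
  also have "\<dots> = (a'/a - c'/c) / 2 * (C / D^3) + (b'/b - c'/c) / 2 * (S / D^3)
      - (a'/a + b'/b + c'/c) / 2 * (1 / (y * D)) + (b'/b - a'/a) / 2 * N"
    by (simp add: diff_divide_distrib add_divide_distrib algebra_simps)
  finally show ?thesis .
qed

text \<open>The integral of the third kind has constant residues, so its derivatives reduce to integrals of
  the second kind, up to the exact differential of \<open>sin \<theta> cos \<theta> / (y sqrt (c - y))\<close> with
  \<open>y = a cos^2 \<theta> + b sin^2 \<theta>\<close>.\<close>

lemma third_kind_derivative:
  fixes a b c a' b' c' :: "real \<Rightarrow> real"
  defines "X \<equiv> \<lambda>t. integral {0..pi/2}
    (\<lambda>\<theta>. 1 / (cos_sin_mean (a t) (b t) \<theta> * sqrt (cos_sin_mean (c t - a t) (c t - b t) \<theta>)))"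
  assumes d: "0 < d"
    and a: "\<And>t. t \<in> ball t0 d \<Longrightarrow> (a has_real_derivative a' t) (at t)"
    and b: "\<And>t. t \<in> ball t0 d \<Longrightarrow> (b has_real_derivative b' t) (at t)"
    and c: "\<And>t. t \<in> ball t0 d \<Longrightarrow> (c has_real_derivative c' t) (at t)"
    and a': "continuous_on (ball t0 d) a'" and b': "continuous_on (ball t0 d) b'"
    and c': "continuous_on (ball t0 d) c'"
    and ord: "\<And>t. t \<in> ball t0 d \<Longrightarrow> 0 < a t \<and> a t < b t \<and> b t < c t"
  shows "(X has_real_derivative
    (a' t0 / a t0 - c' t0 / c t0) / 2 * cos_integral (c t0 - a t0) (c t0 - b t0)
    + (b' t0 / b t0 - c' t0 / c t0) / 2 * sin_integral (c t0 - a t0) (c t0 - b t0)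
    - (a' t0 / a t0 + b' t0 / b t0 + c' t0 / c t0) / 2 * X t0) (at t0)"
proof -
  define y where "y t \<theta> = cos_sin_mean (a t) (b t) \<theta>" for t \<theta>
  define D where "D t \<theta> = sqrt (cos_sin_mean (c t - a t) (c t - b t) \<theta>)" for t \<theta>
  define f' where "f' t \<theta> = - cos_sin_mean (a' t) (b' t) \<theta> / ((y t \<theta>)^2 * D t \<theta>)
    - (c' t - cos_sin_mean (a' t) (b' t) \<theta>) / (2 * y t \<theta> * (D t \<theta>)^3)" for t \<theta>
  have X: "X = (\<lambda>t. integral {0..pi/2} (\<lambda>\<theta>. 1 / (y t \<theta> * D t \<theta>)))"
    by (simp add: X_def y_def D_def)
  have y: "0 < y t \<theta>" and D: "0 < D t \<theta>" "(D t \<theta>)^2 = c t - y t \<theta>"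
     and m: "0 < cos_sin_mean (c t - a t) (c t - b t) \<theta>" if "t \<in> ball t0 d" for t \<theta>
    using cos_sin_mean_pos[of "a t" "b t" \<theta>] cos_sin_mean_pos[of "c t - a t" "c t - b t" \<theta>] ord[OF that]
    by (auto simp: y_def D_def cos_sin_mean_affine(2))
  have ac: "continuous_on (ball t0 d) a" and bc: "continuous_on (ball t0 d) b"
    and cc: "continuous_on (ball t0 d) c"
    by (rule DERIV_continuous_on,
        erule has_field_derivative_at_within[OF a] has_field_derivative_at_within[OF b] has_field_derivative_at_within[OF c])+
  have ycont: "continuous_on (ball t0 d \<times> {0..pi/2}) (\<lambda>x. y (fst x) (snd x))"
    and Dcont: "continuous_on (ball t0 d \<times> {0..pi/2}) (\<lambda>x. D (fst x) (snd x))"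
    unfolding y_def D_def
    by (intro continuous_intros ac[THEN continuous_on_fst_compose] bc[THEN continuous_on_fst_compose]
        cc[THEN continuous_on_fst_compose])+
  have "(X has_real_derivative integral {0..pi/2} (f' t0)) (at t0)"
    unfolding X
  proof (rule leibniz_rule_open_interval[OF _ _ _ d])
    fix t \<theta> assume t: "t \<in> ball t0 d"
    have "continuous_on {0..pi/2} (y t)" "continuous_on {0..pi/2} (D t)"
      unfolding y_def[abs_def] D_def[abs_def] by (intro continuous_intros)+
    then show "(\<lambda>\<theta>. 1 / (y t \<theta> * D t \<theta>)) integrable_on {0..pi/2}"
      using y[OF t] D[OF t] by (intro integrable_continuous_real continuous_intros) (auto simp: less_le)
    have y': "((\<lambda>t. y t \<theta>) has_real_derivative cos_sin_mean (a' t) (b' t) \<theta>) (at t)"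
      unfolding y_def cos_sin_mean_def using a[OF t] b[OF t] by (auto intro!: derivative_eq_intros)
    have "((\<lambda>t. cos_sin_mean (c t - a t) (c t - b t) \<theta>) has_real_derivative
        c' t - cos_sin_mean (a' t) (b' t) \<theta>) (at t)"
      unfolding cos_sin_mean_affine(2)[symmetric] using y'[unfolded y_def] c[OF t]
      by (intro DERIV_diff)
    then have "((\<lambda>t. D t \<theta>) has_real_derivative
        inverse (D t \<theta>) / 2 * (c' t - cos_sin_mean (a' t) (b' t) \<theta>)) (at t)"
      unfolding D_def using m[OF t] by (rule DERIV_sqrt_compose)
    then have "((\<lambda>t. 1 / (y t \<theta> * D t \<theta>)) has_real_derivative
        (0 * (y t \<theta> * D t \<theta>) - 1 * (cos_sin_mean (a' t) (b' t) \<theta> * D t \<theta>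
          + inverse (D t \<theta>) / 2 * (c' t - cos_sin_mean (a' t) (b' t) \<theta>) * y t \<theta>))
         / ((y t \<theta> * D t \<theta>) * (y t \<theta> * D t \<theta>))) (at t)"
      using y'  y[OF t] D[OF t] by (intro DERIV_divide DERIV_const DERIV_mult) (auto simp: less_le)
    moreover have "(0 * (y t \<theta> * D t \<theta>) - 1 * (cos_sin_mean (a' t) (b' t) \<theta> * D t \<theta>
          + inverse (D t \<theta>) / 2 * (c' t - cos_sin_mean (a' t) (b' t) \<theta>) * y t \<theta>))
         / ((y t \<theta> * D t \<theta>) * (y t \<theta> * D t \<theta>)) = f' t \<theta>"
      using y[OF t, of \<theta>] D(1)[OF t, of \<theta>]
      by (simp add: f'_def divide_simps power2_eq_square power3_eq_cube) (simp add: algebra_simps)?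
    ultimately show "((\<lambda>t. 1 / (y t \<theta> * D t \<theta>)) has_real_derivative f' t \<theta>) (at t)"
      by simp
  next
    show "continuous_on (ball t0 d \<times> {0..pi/2}) (\<lambda>(t, \<theta>). f' t \<theta>)"
      unfolding f'_def split_beta using y D(1)
      by (intro continuous_intros a'[THEN continuous_on_fst_compose] b'[THEN continuous_on_fst_compose]
          c'[THEN continuous_on_fst_compose] ycont Dcont) (auto simp: less_le)
  qed
  moreover have "(f' t0 has_integral
      ((a' t0 / a t0 - c' t0 / c t0) / 2 * cos_integral (c t0 - a t0) (c t0 - b t0)
    + (b' t0 / b t0 - c' t0 / c t0) / 2 * sin_integral (c t0 - a t0) (c t0 - b t0)
    - (a' t0 / a t0 + b' t0 / b t0 + c' t0 / c t0) / 2 * X t0 + (b' t0 / b t0 - a' t0 / a t0) / 2 * 0)) {0..pi/2}"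
  proof -
    have t0: "t0 \<in> ball t0 d" using d by simp
    note y = y[OF t0] and D = D[OF t0] and ord = ord[OF t0]
    \<comment> \<open>The derivative of \<open>sin \<theta> * cos \<theta> / (y t0 \<theta> * D t0
      \<theta>)\<close>; its integral is the factor 0 in the last term of the claim.\<close>
    define N where "N \<theta> = (((cos \<theta>)^2 - (sin \<theta>)^2) * y t0 \<theta> * (D t0 \<theta>)^2
      - 2 * (b t0 - a t0) * (sin \<theta>)^2 * (cos \<theta>)^2 * (D t0 \<theta>)^2
      + (b t0 - a t0) * (sin \<theta>)^2 * (cos \<theta>)^2 * y t0 \<theta>) / ((y t0 \<theta>)^2 * (D t0 \<theta>)^3)" for \<theta>
    have "((\<lambda>\<theta>. sin \<theta> * cos \<theta> / (y t0 \<theta> * D t0 \<theta>)) has_real_derivative N \<theta>) (at \<theta>)" for \<theta>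
    proof -
      have "((\<lambda>\<theta>. D t0 \<theta>) has_real_derivative
          (a t0 - b t0) * sin \<theta> * cos \<theta> / D t0 \<theta>) (at \<theta>)"
        using sqrt_cos_sin_mean_derivative[of "c t0 - a t0" "c t0 - b t0" \<theta>] ord
        unfolding D_def by simp
      moreover have "((\<lambda>\<theta>. y t0 \<theta>) has_real_derivative 2 * (b t0 - a t0) * sin \<theta> * cos \<theta>) (at \<theta>)"
        using cos_sin_mean_derivative[of "a t0" "b t0" \<theta>] by (simp add: y_def)
      ultimately have "((\<lambda>\<theta>. sin \<theta> * cos \<theta> / (y t0 \<theta> * D t0 \<theta>)) has_real_derivative
          ((cos \<theta> * cos \<theta> + (- sin \<theta>) * sin \<theta>) * (y t0 \<theta> * D t0 \<theta>)
            - sin \<theta> * cos \<theta> * (2 * (b t0 - a t0) * sin \<theta> * cos \<theta> * D t0 \<theta>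
               + (a t0 - b t0) * sin \<theta> * cos \<theta> / D t0 \<theta> * y t0 \<theta>))
           / ((y t0 \<theta> * D t0 \<theta>) * (y t0 \<theta> * D t0 \<theta>))) (at \<theta>)"
        using y[of \<theta>] D(1)[of \<theta>] by (intro DERIV_divide DERIV_mult DERIV_sin DERIV_cos) auto
      moreover have "((cos \<theta> * cos \<theta> + (- sin \<theta>) * sin \<theta>) * (y t0 \<theta> * D t0 \<theta>)
            - sin \<theta> * cos \<theta> * (2 * (b t0 - a t0) * sin \<theta> * cos \<theta> * D t0 \<theta>
               + (a t0 - b t0) * sin \<theta> * cos \<theta> / D t0 \<theta> * y t0 \<theta>))
           / ((y t0 \<theta> * D t0 \<theta>) * (y t0 \<theta> * D t0 \<theta>)) = N \<theta>"
        using y[of \<theta>] D(1)[of \<theta>] unfolding N_def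
        by (simp add: divide_simps power2_eq_square power3_eq_cube) (simp add: algebra_simps)?
      ultimately show ?thesis by simp
    qed
    then have "(N has_integral sin (pi/2) * cos (pi/2) / (y t0 (pi/2) * D t0 (pi/2))
       - sin 0 * cos 0 / (y t0 0 * D t0 0)) {0..pi/2}"
      by (intro fundamental_theorem_of_calculus)
         (auto simp: has_real_derivative_iff_has_vector_derivative[symmetric] intro: has_field_derivative_at_within)
    then have N: "(N has_integral 0) {0..pi/2}" by simp
    have "continuous_on {0..pi/2} (y t0)" "continuous_on {0..pi/2} (D t0)"
      unfolding y_def[abs_def] D_def[abs_def] by (intro continuous_intros)+
    then have "(\<lambda>\<theta>. 1 / (y t0 \<theta> * D t0 \<theta>)) integrable_on {0..pi/2}"
      using y D by (intro integrable_continuous_real continuous_intros) (auto simp: less_le)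
    then have Xi: "((\<lambda>\<theta>. 1 / (y t0 \<theta> * D t0 \<theta>)) has_integral X t0) {0..pi/2}"
      unfolding X by (rule integrable_integral)
    have pq: "0 < c t0 - a t0" "0 < c t0 - b t0" using ord by auto
    have "f' t0 \<theta> = (a' t0 / a t0 - c' t0 / c t0) / 2 * ((cos \<theta>)^2 / (D t0 \<theta>)^3)
      + (b' t0 / b t0 - c' t0 / c t0) / 2 * ((sin \<theta>)^2 / (D t0 \<theta>)^3)
      - (a' t0 / a t0 + b' t0 / b t0 + c' t0 / c t0) / 2 * (1 / (y t0 \<theta> * D t0 \<theta>))
      + (b' t0 / b t0 - a' t0 / a t0) / 2 * N \<theta>" for \<theta>
      unfolding f'_def cos_sin_mean_def
      by (rule third_kind_integrand_identity)
         (use ord y[of \<theta>] D[of \<theta>] in \<open>auto simp: N_def y_def cos_sin_mean_def\<close>)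
    then have "f' t0 = (\<lambda>\<theta>. (a' t0 / a t0 - c' t0 / c t0) / 2 * ((cos \<theta>)^2 / (D t0 \<theta>)^3)
      + (b' t0 / b t0 - c' t0 / c t0) / 2 * ((sin \<theta>)^2 / (D t0 \<theta>)^3)
      - (a' t0 / a t0 + b' t0 / b t0 + c' t0 / c t0) / 2 * (1 / (y t0 \<theta> * D t0 \<theta>))
      + (b' t0 / b t0 - a' t0 / a t0) / 2 * N \<theta>)"
      by (rule ext)
    then show ?thesis
      using cos_sin_integral_has_integral[OF pq, folded D_def] N Xi
      by (simp only:) (intro has_integral_add has_integral_diff has_integral_mult_right)
  qed
  ultimately show ?thesis by (simp add: integral_unique)
qed

text \<open>The usual antiderivative, a multiple of
  \<open>arctan (\<beta> / \<alpha> * tan \<theta>)\<close>, breaks down at pi/2. By the subtraction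
  formula for arctan it equals the angle plus a bounded arctan term, and this form \<open>G\<close>
  is smooth on the closed interval.\<close>

lemma integral_inverse_cos_sin_mean:
  assumes "0 < a" "0 < b"
  shows "((\<lambda>\<theta>. 1 / cos_sin_mean a b \<theta>) has_integral pi / (2 * sqrt (a * b))) {0..pi/2}"
proof -
  define \<alpha> \<beta> where "\<alpha> = sqrt a" and "\<beta> = sqrt b"
  have ab: "0 < \<alpha>" "0 < \<beta>" "a = \<alpha>^2" "b = \<beta>^2" using assms by (auto simp: \<alpha>_def \<beta>_def)
  define G where "G \<theta> = (\<theta> + arctan ((\<beta> - \<alpha>) * sin \<theta> * cos \<theta> / cos_sin_mean \<alpha> \<beta> \<theta>)) / (\<alpha> * \<beta>)" for \<theta>
  have "(G has_real_derivative 1 / cos_sin_mean a b \<theta>) (at \<theta>)" for \<theta>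
  proof -
    define s c m where "s = sin \<theta>" and "c = cos \<theta>" and "m = cos_sin_mean \<alpha> \<beta> \<theta>"
    have cs: "c^2 + s^2 = 1" by (simp add: s_def c_def)
    have m: "0 < m" "m = \<alpha> * c^2 + \<beta> * s^2"
      unfolding m_def using ab cos_sin_mean_pos[of \<alpha> \<beta> \<theta>] by (auto simp: cos_sin_mean_def s_def c_def)
    define g' where "g' = (((\<beta> - \<alpha>) * c * c - (\<beta> - \<alpha>) * s * s) * m
        - (\<beta> - \<alpha>) * s * c * (2 * (\<beta> - \<alpha>) * s * c)) / (m * m)"
    have "((\<lambda>\<theta>. (\<beta> - \<alpha>) * sin \<theta> * cos \<theta> / cos_sin_mean \<alpha> \<beta> \<theta>) has_real_derivative g') (at \<theta>)"
      unfolding g'_def using m(1) unfolding s_def c_def m_def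
      by (intro DERIV_divide cos_sin_mean_derivative)
         (auto intro!: derivative_eq_intros)
    from DERIV_cdivide[OF DERIV_add[OF DERIV_ident DERIV_chain2[OF DERIV_arctan this]], of "\<alpha> * \<beta>"]
    have "(G has_real_derivative (1 + inverse (1 + ((\<beta> - \<alpha>) * s * c / m)^2) * g') / (\<alpha> * \<beta>)) (at \<theta>)"
      unfolding G_def[abs_def] s_def c_def m_def .
    moreover have "(1 + inverse (1 + ((\<beta> - \<alpha>) * s * c / m)^2) * g') / (\<alpha> * \<beta>) = 1 / cos_sin_mean a b \<theta>"
    proof -
      define M where "M = \<alpha>^2 * c^2 + \<beta>^2 * s^2"
      have M: "0 < M" "cos_sin_mean a b \<theta> = M"
        using cos_sin_mean_pos[OF assms, of \<theta>] ab by (auto simp: M_def cos_sin_mean_def s_def c_def)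
      \<comment> \<open>The squared modulus of
        \<open>(\<alpha> * c + i * \<beta> * s) * (c - i * s)\<close>, whose second factor has
        modulus 1.\<close>
      have 1: "m^2 + ((\<beta> - \<alpha>) * s * c)^2 = M" unfolding m(2) M_def using cs by algebra
      have "1 + ((\<beta> - \<alpha>) * s * c / m)^2 = M / m^2"
        using m(1) by (simp add: 1[symmetric] power_divide add_divide_distrib)
      then have "1 + inverse (1 + ((\<beta> - \<alpha>) * s * c / m)^2) * g'
        = (M + (((\<beta> - \<alpha>) * c * c - (\<beta> - \<alpha>) * s * s) * m
        - (\<beta> - \<alpha>) * s * c * (2 * (\<beta> - \<alpha>) * s * c))) / M"
        using m(1) M(1) by (simp add: g'_def field_simps power2_eq_square)
      also have "M + (((\<beta> - \<alpha>) * c * c - (\<beta> - \<alpha>) * s * s) * m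
        - (\<beta> - \<alpha>) * s * c * (2 * (\<beta> - \<alpha>) * s * c)) = \<alpha> * \<beta>"
        unfolding m(2) M_def using cs by algebra
      finally show ?thesis using ab M by simp
    qed
    ultimately show ?thesis by simp
  qed
  then have "((\<lambda>\<theta>. 1 / cos_sin_mean a b \<theta>) has_integral G (pi/2) - G 0) {0..pi/2}"
    by (intro fundamental_theorem_of_calculus)
       (auto simp: has_real_derivative_iff_has_vector_derivative[symmetric] intro: has_field_derivative_at_within)
  moreover have "G (pi/2) - G 0 = pi / (2 * sqrt (a * b))"
    by (simp add: G_def \<alpha>_def \<beta>_def real_sqrt_mult)
  ultimately show ?thesis by simp
qed

text \<open>Subtracting \<open>\<pi> sign J\<close> cancels the singularity at \<open>J = 0\<close>, where \<open>a = 0\<close>.\<close>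

lemma renormalized_phase_eq:
  assumes r: "cubic_roots (4*E) (2*J^2) a b c" and E: "0 < E"
  shows "renormalized_phase J E = 2 * sqrt 2 * J * integral {0..pi/2}
     (\<lambda>\<theta>. 1 / (sqrt (cos_sin_mean (c - a) (c - b) \<theta>) * sqrt c * (sqrt c + sqrt (cos_sin_mean (c - a) (c - b) \<theta>))))"
proof (cases "J = 0")
  case True
  then show ?thesis by (simp add: renormalized_phase_def)
next
  case False
  note bnd = cubic_roots_bounds[OF r]
  have a: "0 < a" "0 < b" "0 < c" "a < b" "b < c" using bnd E False r by (auto simp: cubic_roots_def)
  define D where "D \<theta> = sqrt (cos_sin_mean (c - a) (c - b) \<theta>)" for \<theta>
  define y where "y \<theta> = cos_sin_mean a b \<theta>" for \<theta>
  have y: "0 < y \<theta>" and D: "0 < D \<theta>" "(D \<theta>)^2 = c - y \<theta>" for \<theta>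
    using cos_sin_mean_pos[of a b \<theta>] cos_sin_mean_pos[of "c - a" "c - b" \<theta>] a
    by (auto simp: y_def D_def cos_sin_mean_affine(2))
  have cont: "continuous_on {0..pi/2} y" "continuous_on {0..pi/2} D"
    unfolding y_def[abs_def] D_def[abs_def] by (intro continuous_intros)+
  have "(\<lambda>\<theta>. 1 / (y \<theta> * D \<theta>)) integrable_on {0..pi/2}"
    using y D cont by (intro integrable_continuous_real continuous_intros) (auto simp: less_le)
  then have "((\<lambda>\<theta>. 1 / (y \<theta> * D \<theta>) - 1 / sqrt c * (1 / y \<theta>)) has_integral
      integral {0..pi/2} (\<lambda>\<theta>. 1 / (y \<theta> * D \<theta>)) - 1 / sqrt c * (pi / (2 * sqrt (a * b)))) {0..pi/2}"
    using integral_inverse_cos_sin_mean[OF a(1,2), folded y_def]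
    by (intro has_integral_diff has_integral_mult_right integrable_integral)
  \<comment> \<open>Since \<open>y = (sqrt c - D) * (sqrt c + D)\<close>, the numerator
    \<open>sqrt c - D\<close> of the difference cancels the factor that vanishes with y.\<close>
  moreover have "1 / (y \<theta> * D \<theta>) - 1 / sqrt c * (1 / y \<theta>) = 1 / (D \<theta> * sqrt c * (sqrt c + D \<theta>))" for \<theta>
  proof -
    have "y \<theta> = (sqrt c - D \<theta>) * (sqrt c + D \<theta>)"
      using D(2)[of \<theta>] a by (simp add: algebra_simps power2_eq_square)
    moreover have "0 < sqrt c" "0 < sqrt c + D \<theta>" using a D(1)[of \<theta>] by (auto intro: add_pos_pos)
    moreover have "1 / (y \<theta> * D \<theta>) - 1 / sqrt c * (1 / y \<theta>) = (sqrt c - D \<theta>) / (y \<theta> * D \<theta> * sqrt c)"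
      using y[of \<theta>] D(1)[of \<theta>] a by (simp add: field_simps)
    ultimately show ?thesis using y[of \<theta>] D(1)[of \<theta>] by auto
  qed
  ultimately have e: "integral {0..pi/2} (\<lambda>\<theta>. 1 / (y \<theta> * D \<theta>)) - 1 / sqrt c * (pi / (2 * sqrt (a * b)))
    = integral {0..pi/2} (\<lambda>\<theta>. 1 / (D \<theta> * sqrt c * (sqrt c + D \<theta>)))"
    by (simp add: integral_unique)
  \<comment> \<open>Because \<open>a*b*c = 2*J^2\<close>, the multiple of the integral of 1/y that
    was subtracted is exactly the renormalizing constant.\<close>
  moreover have "2 * sqrt 2 * J * (1 / sqrt c * (pi / (2 * sqrt (a * b)))) = pi * sgn J"
  proof -
    have "sqrt c * sqrt (a * b) = sqrt (2 * J^2)"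
      using r by (simp add: cubic_roots_def real_sqrt_mult[symmetric] mult_ac)
    then have "sqrt c * sqrt (a * b) = sqrt 2 * \<bar>J\<bar>" by (simp add: real_sqrt_mult)
    moreover have "2 * w * J * (1 / v * (pi / (2 * z))) = w * J * pi / (v * z)" for w v z :: real
      by simp
    ultimately have "2 * sqrt 2 * J * (1 / sqrt c * (pi / (2 * sqrt (a * b)))) = sqrt 2 * J * pi / (sqrt 2 * \<bar>J\<bar>)"
      by (simp only:)
    also have "\<dots> = pi * sgn J" using False by (simp add: sgn_if)
    finally show ?thesis .
  qed
  ultimately have "2 * sqrt 2 * J * integral {0..pi/2} (\<lambda>\<theta>. 1 / (y \<theta> * D \<theta>)) - pi * sgn J
    = 2 * sqrt 2 * J * integral {0..pi/2} (\<lambda>\<theta>. 1 / (D \<theta> * sqrt c * (sqrt c + D \<theta>)))"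
    by (simp only: e[symmetric] right_diff_distrib)
  then show ?thesis
    using False phase_eq[OF r E False] by (simp add: renormalized_phase_def y_def D_def)
qed

section \<open>The partial derivatives and the determinant\<close>

lemma eventually_nhds_ball:
  fixes t0 :: real
  assumes "eventually P (nhds t0)" "0 < d"
  obtains d' where "0 < d'" "d' \<le> d" "\<And>t. t \<in> ball t0 d' \<Longrightarrow> P t"
proof -
  obtain e where e: "0 < e" "\<And>t. dist t t0 < e \<Longrightarrow> P t"
    using assms(1) unfolding eventually_nhds_metric by auto
  show ?thesis
    by (rule that[of "min e d"]) (use e assms(2) in \<open>auto simp: dist_commute\<close>)
qed

text \<open>Stated along a differentiable curve in the parameter plane, so that both partial
  derivatives are instances, with one of \<open>j\<close> and \<open>e\<close> constant and the
  other the identity.\<close>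

lemma
  fixes j e j' e' :: "real \<Rightarrow> real" and t0 a b c :: real
  defines "A \<equiv> cos_integral (c - a) (c - b)" and "B \<equiv> sin_integral (c - a) (c - b)"
  defines "a' \<equiv> (4 * j t0 * j' t0 - 4 * e' t0 * a) / ((a - b) * (a - c))"
    and "b' \<equiv> (4 * j t0 * j' t0 - 4 * e' t0 * b) / ((b - a) * (b - c))"
    and "c' \<equiv> (4 * j t0 * j' t0 - 4 * e' t0 * c) / ((c - a) * (c - b))"
  assumes r: "cubic_roots (4 * e t0) (2 * (j t0)^2) a b c" and e0: "0 < e t0"
    and j: "\<And>t. (j has_real_derivative j' t) (at t)" and e: "\<And>t. (e has_real_derivative e' t) (at t)"
    and j': "continuous_on UNIV j'" and e': "continuous_on UNIV e'"
  shows period_derivative: "((\<lambda>t. period (j t) (e t)) has_real_derivative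
      - sqrt 2 * ((c' - a') * A + (c' - b') * B)) (at t0)"
    and renormalized_phase_derivative: "j t0 \<noteq> 0 \<Longrightarrow>
      ((\<lambda>t. renormalized_phase (j t) (e t)) has_real_derivative
      sqrt 2 * j t0 * ((a'/a - c'/c) * A + (b'/b - c'/c) * B)) (at t0)"
proof -
  define u' s' where "u' t = 4 * e' t" and "s' t = 4 * j t * j' t" for t
  have u: "((\<lambda>t. 4 * e t) has_real_derivative u' t) (at t)" for t
    unfolding u'_def using e by (rule DERIV_cmult)
  have s: "((\<lambda>t. 2 * (j t)^2) has_real_derivative s' t) (at t)" for t
    unfolding s'_def using j by (auto intro!: derivative_eq_intros)
  have jc: "continuous_on U j" and ec: "continuous_on U e" for U
    using j e by (auto intro: DERIV_continuous_on has_field_derivative_at_within)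
  have u'c: "continuous_on U u'" and s'c: "continuous_on U s'" for U
    unfolding u'_def s'_def
    by (intro continuous_intros continuous_on_subset[OF j'] continuous_on_subset[OF e'] jc; simp)+
  obtain d1 fa fb fc where d1: "0 < d1" and at0: "fa t0 = a" "fb t0 = b" "fc t0 = c"
    and R: "\<And>t. t \<in> ball t0 d1 \<Longrightarrow> cubic_roots (4 * e t) (2 * (j t)^2) (fa t) (fb t) (fc t)"
    and fa: "\<And>t. t \<in> ball t0 d1 \<Longrightarrow>
      (fa has_real_derivative (s' t - u' t * fa t) / ((fa t - fb t) * (fa t - fc t))) (at t)"
    and fb: "\<And>t. t \<in> ball t0 d1 \<Longrightarrow>
      (fb has_real_derivative (s' t - u' t * fb t) / ((fb t - fa t) * (fb t - fc t))) (at t)"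
    and fc: "\<And>t. t \<in> ball t0 d1 \<Longrightarrow>
      (fc has_real_derivative (s' t - u' t * fc t) / ((fc t - fa t) * (fc t - fb t))) (at t)"
    using cubic_roots_path[of "\<lambda>t. 4 * e t" t0 "\<lambda>t. 2 * (j t)^2" a b c, OF r u s] by blast
  have "(e \<longlongrightarrow> e t0) (nhds t0)"
    using DERIV_isCont[OF e] by (simp add: continuous_at tendsto_at_iff_tendsto_nhds)
  from order_tendstoD(1)[OF this e0] obtain d where d: "0 < d" "d \<le> d1"
    and epos: "\<And>t. t \<in> ball t0 d \<Longrightarrow> 0 < e t"
    using d1 eventually_nhds_ball by metis
  define ga gb gc where "ga t = (s' t - u' t * fa t) / ((fa t - fb t) * (fa t - fc t))"
    and "gb t = (s' t - u' t * fb t) / ((fb t - fa t) * (fb t - fc t))"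
    and "gc t = (s' t - u' t * fc t) / ((fc t - fa t) * (fc t - fb t))" for t
  have sub: "t \<in> ball t0 d1" if "t \<in> ball t0 d" for t using that d(2) by auto
  note R = R[OF sub]
  note fa = fa[OF sub, folded ga_def] and fb = fb[OF sub, folded gb_def] and fc = fc[OF sub, folded gc_def]
  have ord: "fa t < fb t" "fb t < fc t" if "t \<in> ball t0 d" for t
    using R[OF that] by (auto simp: cubic_roots_def)
  have t0: "t0 \<in> ball t0 d" using d by simp
  have g0: "ga t0 = a'" "gb t0 = b'" "gc t0 = c'"
    by (simp_all add: ga_def gb_def gc_def a'_def b'_def c'_def at0 u'_def s'_def)
  have cont: "continuous_on (ball t0 d) fa" "continuous_on (ball t0 d) fb" "continuous_on (ball t0 d) fc"
    by (rule DERIV_continuous_on, erule has_field_derivative_at_within[OF fa]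
        has_field_derivative_at_within[OF fb] has_field_derivative_at_within[OF fc])+
  have ne: "fa t \<noteq> fb t" "fa t \<noteq> fc t" "fb t \<noteq> fc t" if "t \<in> ball t0 d" for t
    using ord[OF that] by auto
  have gcont: "continuous_on (ball t0 d) ga" "continuous_on (ball t0 d) gb" "continuous_on (ball t0 d) gc"
    unfolding ga_def gb_def gc_def using ne
    by (intro continuous_intros cont u'c s'c; force)+
  show "((\<lambda>t. period (j t) (e t)) has_real_derivative
      - sqrt 2 * ((c' - a') * A + (c' - b') * B)) (at t0)"
  proof (rule has_field_derivative_transform_within_open[OF _ open_ball t0])
    have "((\<lambda>t. integral {0..pi/2} (\<lambda>\<theta>. 1 / sqrt (cos_sin_mean (fc t - fa t) (fc t - fb t) \<theta>)))
      has_real_derivative - ((gc t0 - ga t0) * cos_integral (fc t0 - fa t0) (fc t0 - fb t0)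
        + (gc t0 - gb t0) * sin_integral (fc t0 - fa t0) (fc t0 - fb t0)) / 2) (at t0)"
      by (rule first_kind_derivative[OF d(1)])
        (use ord in \<open>auto intro!: DERIV_diff fa fb fc continuous_on_diff gcont simp del: mem_ball dest: less_trans\<close>)
    from DERIV_cmult[OF this, of "2 * sqrt 2"]
    show "((\<lambda>t. 2 * sqrt 2 * integral {0..pi/2} (\<lambda>\<theta>. 1 / sqrt (cos_sin_mean (fc t - fa t) (fc t - fb t) \<theta>)))
      has_real_derivative - sqrt 2 * ((c' - a') * A + (c' - b') * B)) (at t0)"
      by (rule DERIV_cong) (simp add: g0 at0 A_def B_def field_simps)
    show "2 * sqrt 2 * integral {0..pi/2} (\<lambda>\<theta>. 1 / sqrt (cos_sin_mean (fc t - fa t) (fc t - fb t) \<theta>))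
        = period (j t) (e t)" if "t \<in> ball t0 d" for t
      using period_eq[OF R[OF that] epos[OF that]] by simp
  qed
  assume j0: "j t0 \<noteq> 0"
  have jt: "(j \<longlongrightarrow> j t0) (nhds t0)"
    using DERIV_isCont[OF j] by (simp add: continuous_at tendsto_at_iff_tendsto_nhds)
  \<comment> \<open>Near \<open>t0\<close> the sign is frozen, so the subtracted multiple of pi is
    locally constant and only the phase has to be differentiated.\<close>
  have "\<forall>\<^sub>F t in nhds t0. sgn (j t) = sgn (j t0)"
  proof (cases "0 < j t0")
    case True
    then show ?thesis using order_tendstoD(1)[OF jt True] by (auto elim: eventually_mono)
  next
    case False
    then have "j t0 < 0" using j0 by simp
    then show ?thesis using order_tendstoD(2)[OF jt, of 0] by (auto elim: eventually_mono)
  qed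
  then obtain d2 where d2: "0 < d2" "d2 \<le> d" and sg: "\<And>t. t \<in> ball t0 d2 \<Longrightarrow> sgn (j t) = sgn (j t0)"
    using d(1) eventually_nhds_ball[of "\<lambda>t. sgn (j t) = sgn (j t0)" t0 d] by blast
  have jn: "j t \<noteq> 0" if "t \<in> ball t0 d2" for t using sg[OF that] j0 by (metis sgn_0_0)
  have sub2: "t \<in> ball t0 d" if "t \<in> ball t0 d2" for t using that d2(2) by auto
  have subs: "ball t0 d2 \<subseteq> ball t0 d" using sub2 by blast
  have ord2: "0 < fa t \<and> fa t < fb t \<and> fb t < fc t" if "t \<in> ball t0 d2" for t
    using cubic_roots_bounds(4)[OF R[OF sub2[OF that]]] epos[OF sub2[OF that]] jn[OF that] ord[OF sub2[OF that]]
    by simp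
  define X where "X t = integral {0..pi/2}
    (\<lambda>\<theta>. 1 / (cos_sin_mean (fa t) (fb t) \<theta> * sqrt (cos_sin_mean (fc t - fa t) (fc t - fb t) \<theta>)))" for t
  have X': "(X has_real_derivative (a'/a - c'/c) / 2 * A + (b'/b - c'/c) / 2 * B
      - (a'/a + b'/b + c'/c) / 2 * X t0) (at t0)"
    using third_kind_derivative[OF d2(1) fa[OF sub2] fb[OF sub2] fc[OF sub2]
        gcont[THEN continuous_on_subset, OF subs] ord2]
    unfolding g0 at0 A_def B_def X_def[abs_def] by blast
  \<comment> \<open>The logarithmic derivative of \<open>a*b*c = 2*J^2\<close>. It makes the
    \<open>X t0\<close> term of the derivative of \<open>X\<close> cancel against the derivative of
    the prefactor \<open>j\<close>.\<close>
  have prod': "a'/a + b'/b + c'/c = 2 * j' t0 / j t0"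
  proof -
    have "((\<lambda>t. fa t * fb t * fc t) has_real_derivative (ga t0 * fb t0 + gb t0 * fa t0) * fc t0
        + gc t0 * (fa t0 * fb t0)) (at t0)"
      by (intro DERIV_mult fa fb fc t0)
    moreover have "((\<lambda>t. fa t * fb t * fc t) has_real_derivative s' t0) (at t0)"
      by (rule has_field_derivative_transform_within_open[OF s open_ball t0])
        (use R in \<open>simp add: cubic_roots_def\<close>)
    ultimately have "(a' * b + b' * a) * c + c' * (a * b) = 4 * j t0 * j' t0"
      using DERIV_unique unfolding g0 at0 s'_def by blast
    moreover have "a * b * c = 2 * (j t0)^2" using r by (simp add: cubic_roots_def)
    moreover have "0 < a" "0 < b" "0 < c" using ord2[of t0] d2(1) at0 by auto
    then have "a'/a + b'/b + c'/c = ((a' * b + b' * a) * c + c' * (a * b)) / (a * b * c)"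
      by (simp add: divide_simps) (simp add: algebra_simps)?
    ultimately show ?thesis using j0 by (simp add: power2_eq_square)
  qed
  show "((\<lambda>t. renormalized_phase (j t) (e t)) has_real_derivative
      sqrt 2 * j t0 * ((a'/a - c'/c) * A + (b'/b - c'/c) * B)) (at t0)"
  proof (rule has_field_derivative_transform_within_open[OF _ open_ball])
    show "t0 \<in> ball t0 d2" using d2 by simp
    have "((\<lambda>t. 2 * sqrt 2 * (j t * X t) - pi * sgn (j t0)) has_real_derivative
      2 * sqrt 2 * (j' t0 * X t0 + ((a'/a - c'/c) / 2 * A + (b'/b - c'/c) / 2 * B
      - (a'/a + b'/b + c'/c) / 2 * X t0) * j t0) - 0) (at t0)"
      by (intro DERIV_diff DERIV_cmult DERIV_mult DERIV_const j X')
    then show "((\<lambda>t. 2 * sqrt 2 * (j t * X t) - pi * sgn (j t0)) has_real_derivative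
      sqrt 2 * j t0 * ((a'/a - c'/c) * A + (b'/b - c'/c) * B)) (at t0)"
    proof (rule DERIV_cong)
      have "2 * sqrt 2 * (v * x + (\<alpha> / 2 * A + \<beta> / 2 * B - 2 * v / j t0 / 2 * x) * j t0) - 0
        = sqrt 2 * j t0 * (\<alpha> * A + \<beta> * B)" for \<alpha> \<beta> v x
        using j0 by (simp add: field_simps)
      then show "2 * sqrt 2 * (j' t0 * X t0 + ((a'/a - c'/c) / 2 * A + (b'/b - c'/c) / 2 * B
        - (a'/a + b'/b + c'/c) / 2 * X t0) * j t0) - 0
        = sqrt 2 * j t0 * ((a'/a - c'/c) * A + (b'/b - c'/c) * B)"
        unfolding prod' .
    qed
    show "2 * sqrt 2 * (j t * X t) - pi * sgn (j t0) = renormalized_phase (j t) (e t)"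
      if "t \<in> ball t0 d2" for t
      using phase_eq[OF R[OF sub2[OF that]] epos[OF sub2[OF that]] jn[OF that]] jn[OF that] sg[OF that]
      by (simp add: renormalized_phase_def X_def mult.assoc)
  qed
qed

text \<open>Near \<open>J = 0\<close> the renormalized phase is \<open>2 * sqrt 2 * J\<close> times
  an integral that is continuous in \<open>J\<close>; hence the derivative at 0 is the value of
  \<open>2 * sqrt 2\<close> times that integral, whose integrand is positive. Only the sign is used
  later.\<close>

lemma renormalized_phase_derivative_zero:
  assumes r: "cubic_roots (4*E) 0 a b c" and E: "0 < E"
  shows "\<exists>D>0. ((\<lambda>j. renormalized_phase j E) has_real_derivative D) (at 0)"
proof -
  obtain d fa fb fc where d: "0 < d" and at0: "fa 0 = a" "fb 0 = b" "fc 0 = c"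
    and R: "\<And>t. t \<in> ball 0 d \<Longrightarrow> cubic_roots (4 * E) (2 * t^2) (fa t) (fb t) (fc t)"
    and fa: "\<And>t. t \<in> ball 0 d \<Longrightarrow>
      (fa has_real_derivative (4 * t - 0 * fa t) / ((fa t - fb t) * (fa t - fc t))) (at t)"
    and fb: "\<And>t. t \<in> ball 0 d \<Longrightarrow>
      (fb has_real_derivative (4 * t - 0 * fb t) / ((fb t - fa t) * (fb t - fc t))) (at t)"
    and fc: "\<And>t. t \<in> ball 0 d \<Longrightarrow>
      (fc has_real_derivative (4 * t - 0 * fc t) / ((fc t - fa t) * (fc t - fb t))) (at t)"
    by (rule cubic_roots_path[of "\<lambda>t. 4 * E" 0 "\<lambda>t. 2 * t^2" a b c "\<lambda>t. 0" "\<lambda>t. 4 * t"])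
       (use r in \<open>auto intro!: derivative_eq_intros\<close>)
  have ac: "continuous_on (ball 0 d) fa" "continuous_on (ball 0 d) fb" "continuous_on (ball 0 d) fc"
    by (rule DERIV_continuous_on, erule has_field_derivative_at_within[OF fa]
        has_field_derivative_at_within[OF fb] has_field_derivative_at_within[OF fc])+
  define m where "m t \<theta> = cos_sin_mean (fc t - fa t) (fc t - fb t) \<theta>" for t \<theta>
  define k where "k t \<theta> = 1 / (sqrt (m t \<theta>) * sqrt (fc t) * (sqrt (fc t) + sqrt (m t \<theta>)))" for t \<theta>
  have pos: "0 < m t \<theta>" "0 < fc t" if "t \<in> ball 0 d" for t \<theta>
    using R[OF that] cubic_roots_bounds(3)[OF R[OF that]] E
    by (auto simp: m_def cubic_roots_def intro!: cos_sin_mean_pos)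
  have den: "sqrt (m t \<theta>) * sqrt (fc t) * (sqrt (fc t) + sqrt (m t \<theta>)) > 0" if "t \<in> ball 0 d" for t \<theta>
    using pos[OF that] by (intro mult_pos_pos add_pos_pos) auto
  have kcont: "continuous_on (ball 0 d \<times> {0..pi/2}) (\<lambda>(t, \<theta>). k t \<theta>)"
    unfolding k_def m_def split_beta
    by (intro continuous_intros ac[THEN continuous_on_fst_compose] ballI)
       (metis den less_irrefl mem_Times_iff m_def)
  define R where "R t = integral {0..pi/2} (k t)" for t
  have "continuous_on (ball 0 d) R"
    unfolding R_def using integral_continuous_on_param[of "ball 0 d" 0 "pi/2" k] kcont by simp
  then have Rt: "(R \<longlongrightarrow> R 0) (at 0)"
    using d by (simp add: continuous_on_eq_continuous_at continuous_at)
  have eq: "renormalized_phase t E = 2 * sqrt 2 * t * R t" if "t \<in> ball 0 d" for t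
    using renormalized_phase_eq[OF R[OF that] E] unfolding R_def k_def[abs_def] m_def .
  have "\<forall>\<^sub>F t in at 0. 2 * sqrt 2 * R t = (renormalized_phase t E - renormalized_phase 0 E) / (t - 0)"
    unfolding eventually_at_filter
    by (rule eventually_mono[OF eventually_nhds_in_open[of "ball 0 d"]]) (use d eq in auto)
  moreover have "((\<lambda>t. 2 * sqrt 2 * R t) \<longlongrightarrow> 2 * sqrt 2 * R 0) (at 0)"
    by (intro tendsto_intros Rt)
  ultimately have "((\<lambda>j. renormalized_phase j E) has_real_derivative 2 * sqrt 2 * R 0) (at 0)"
    unfolding has_field_derivative_iff by (rule tendsto_cong[THEN iffD1])
  moreover have "0 < R 0"
  proof -
    have "continuous_on {0..pi/2} (\<lambda>\<theta>. case (0, \<theta>) of (t, \<theta>) \<Rightarrow> k t \<theta>)"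
      by (rule continuous_on_compose2[OF kcont]) (use d in \<open>auto intro!: continuous_intros\<close>)
    then have k0: "continuous_on {0..pi/2} (k 0)" by simp
    have nn: "0 < k 0 \<theta>" for \<theta> using den[of 0 \<theta>] d by (simp add: k_def)
    have "0 \<le> R 0" unfolding R_def
      by (intro integral_nonneg integrable_continuous_real k0) (simp add: less_imp_le[OF nn])
    moreover have "R 0 \<noteq> 0"
      using integral_eq_0_iff[OF k0] nn unfolding R_def
      by (metis atLeastAtMost_iff less_imp_le less_irrefl order_refl pi_half_ge_zero pi_half_gt_zero)
    ultimately show ?thesis by simp
  qed
  ultimately show ?thesis by (intro exI[of _ "2 * sqrt 2 * R 0"]) simp
qed

section \<open>The determinant as a quadratic form\<close>

lemma Delta_eq:
  "Delta J E = deriv (\<lambda>e. period J e) E * deriv (\<lambda>j. renormalized_phase j E) J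
    - deriv (\<lambda>e. renormalized_phase J e) E * deriv (\<lambda>j. period j E) J"
  by (simp add: Delta_def det_2)

text \<open>Up to a positive factor the left-hand side is \<open>\<Delta>\<close> as a quadratic form in \<open>A\<close> and \<open>B\<close>; on the
  right every term is positive as soon as \<open>z B \<le> p A\<close>.\<close>

lemma Delta_numerator:
  fixes a b c A B :: real
  defines "x \<equiv> b - a" and "z \<equiv> c - b" and "p \<equiv> c - a"
  shows "((c*x + b*p) * B - (a*z - c*x) * A) * ((z*b*c - x*a*b) * A - (p*a*c + x*a*b) * B)
      + a*b*c * (B * (z + 2*x) - A * (z - x))^2
    = x * z * p * (a * (p*A^2 + 2*x*A*B - z*B^2) + x*p*A*(A + 2*B))"
  unfolding x_def z_def p_def by algebra


theorem proposition2p6: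
  fixes J E :: real
  assumes "(J, E) \<in> param_domain"
  shows "Delta J E > 0"
proof -
  obtain a b c where E: "0 < E" and r: "cubic_roots (4*E) (2*J^2) a b c"
    using param_domain_cubic_roots[OF assms] by blast
  note bnd = cubic_roots_bounds[OF r]
  have ord: "0 \<le> a" "a < b" "b < c" using bnd(1) E r by (auto simp: cubic_roots_def)
  define x z p where "x = b - a" and "z = c - b" and "p = c - a"
  have xz: "0 < x" "0 < z" "0 < p" "p = x + z" "b = a + x" "c = a + x + z"
    using ord by (auto simp: x_def z_def p_def)
  define A B where "A = cos_integral p z" and "B = sin_integral p z"
  have AB: "0 < A" "0 < B" "z * B \<le> p * A"
    using cos_sin_integral_pos[of p z] sin_integral_le_cos_integral[of z p] xz by (auto simp: A_def B_def)
  \<comment> \<open>Numerators over the common denominator \<open>x * z * p\<close>: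
    \<open>U\<close> of the E-derivative of the period, \<open>W\<close> of both mixed
    derivatives.\<close>
  define U W where "U = (c*x + b*p) * B - (a*z - c*x) * A" and "W = B * (z + 2*x) - A * (z - x)"
  have "(a - b) * (a - c) = x * p" "(b - a) * (b - c) = - (x * z)" "(c - a) * (c - b) = p * z"
    by (auto simp: x_def z_def p_def algebra_simps)
  note P = this
  note dE = period_derivative[where ?t0.0 = E and e = "\<lambda>t. t" and j = "\<lambda>t. J"
      and a = a and b = b and c = c and e' = "\<lambda>t. 1" and j' = "\<lambda>t. 0"]
    renormalized_phase_derivative[where ?t0.0 = E and e = "\<lambda>t. t" and j = "\<lambda>t. J"
      and a = a and b = b and c = c and e' = "\<lambda>t. 1" and j' = "\<lambda>t. 0"]
  note dJ = period_derivative[where ?t0.0 = J and e = "\<lambda>t. E" and j = "\<lambda>t. t"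
      and a = a and b = b and c = c and e' = "\<lambda>t. 0" and j' = "\<lambda>t. 1"]
    renormalized_phase_derivative[where ?t0.0 = J and e = "\<lambda>t. E" and j = "\<lambda>t. t"
      and a = a and b = b and c = c and e' = "\<lambda>t. 0" and j' = "\<lambda>t. 1"]
  have TE: "deriv (\<lambda>e. period J e) E = 4 * sqrt 2 * U / (x * z * p)"
  proof (rule DERIV_imp_deriv, rule DERIV_cong[OF dE(1)])
    show "- sqrt 2 *
      (((4 * J * 0 - 4 * 1 * c) / ((c - a) * (c - b)) - (4 * J * 0 - 4 * 1 * a) / ((a - b) * (a - c))) * cos_integral (c - a) (c - b) +
       ((4 * J * 0 - 4 * 1 * c) / ((c - a) * (c - b)) - (4 * J * 0 - 4 * 1 * b) / ((b - a) * (b - c))) * sin_integral (c - a) (c - b))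
      = 4 * sqrt 2 * U / (x * z * p)"
      unfolding P p_def[symmetric] z_def[symmetric] A_def[symmetric] B_def[symmetric] U_def
      using xz(1-3) by (simp add: divide_simps) (simp add: algebra_simps)
  qed (use r E in auto)
  show ?thesis
  proof (cases "J = 0")
    case True
    then have "a = 0" using bnd(5) E by simp
    \<comment> \<open>The only negative contribution to \<open>U\<close> is
      \<open>- a * z * A\<close>, which vanishes here.\<close>
    then have "0 < U" using AB xz by (auto simp: U_def intro!: add_pos_pos mult_pos_pos)
    then have "0 < deriv (\<lambda>e. period J e) E" unfolding TE using xz by simp
    moreover obtain D where "0 < D" "((\<lambda>j. renormalized_phase j E) has_real_derivative D) (at 0)"
      using renormalized_phase_derivative_zero[of E a b c] r E True by auto
    then have "0 < deriv (\<lambda>j. renormalized_phase j E) J" using True DERIV_imp_deriv by metis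
    moreover have "deriv (\<lambda>e. renormalized_phase J e) E = 0"
      using True by (simp add: renormalized_phase_def)
    ultimately show ?thesis by (simp add: Delta_eq)
  next
    case False
    then have a: "0 < a" using bnd(4) E by simp
    have pos: "0 < b" "0 < c" using a ord by auto
    have PE: "deriv (\<lambda>e. renormalized_phase J e) E = 4 * sqrt 2 * J * W / (x * z * p)"
    proof (rule DERIV_imp_deriv, rule DERIV_cong[OF dE(2)])
      show "sqrt 2 * J *
        (((4 * J * 0 - 4 * 1 * a) / ((a - b) * (a - c)) / a - (4 * J * 0 - 4 * 1 * c) / ((c - a) * (c - b)) / c) * cos_integral (c - a) (c - b) +
         ((4 * J * 0 - 4 * 1 * b) / ((b - a) * (b - c)) / b - (4 * J * 0 - 4 * 1 * c) / ((c - a) * (c - b)) / c) * sin_integral (c - a) (c - b))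
        = 4 * sqrt 2 * J * W / (x * z * p)"
        unfolding P p_def[symmetric] z_def[symmetric] A_def[symmetric] B_def[symmetric] W_def
        using xz(1-3) a pos by (simp add: divide_simps) (simp add: xz(4) algebra_simps)
    qed (use r E False in auto)
    \<comment> \<open>The negative of \<open>PE\<close>: for the action \<open>S\<close>, twice the
      integral of \<open>sqrt (2 * (E - V))\<close> between the turning points, the period is the
      E-derivative and the phase is minus the J-derivative.\<close>
    have TJ: "deriv (\<lambda>j. period j E) J = - (4 * sqrt 2 * J * W) / (x * z * p)"
    proof (rule DERIV_imp_deriv, rule DERIV_cong[OF dJ(1)])
      show "- sqrt 2 *
        (((4 * J * 1 - 4 * 0 * c) / ((c - a) * (c - b)) - (4 * J * 1 - 4 * 0 * a) / ((a - b) * (a - c))) * cos_integral (c - a) (c - b) +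
         ((4 * J * 1 - 4 * 0 * c) / ((c - a) * (c - b)) - (4 * J * 1 - 4 * 0 * b) / ((b - a) * (b - c))) * sin_integral (c - a) (c - b))
        = - (4 * sqrt 2 * J * W) / (x * z * p)"
        unfolding P p_def[symmetric] z_def[symmetric] A_def[symmetric] B_def[symmetric] W_def
        using xz(1-3) by (simp add: divide_simps) (simp add: xz(4) algebra_simps)
    qed (use r E in auto)
    \<comment> \<open>What remains of the J-derivative of the phase once
      \<open>J^2 = a*b*c / 2\<close> has cancelled the roots in the denominators.\<close>
    define V where "V = (z*b*c - x*a*b) * A - (p*a*c + x*a*b) * B"
    have J2: "J^2 = a*b*c / 2" using r by (simp add: cubic_roots_def)
    have PJ: "deriv (\<lambda>j. renormalized_phase j E) J = 2 * sqrt 2 * V / (x * z * p)"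
    proof (rule DERIV_imp_deriv, rule DERIV_cong[OF dJ(2)])
      have "sqrt 2 * J *
        (((4 * J * 1 - 4 * 0 * a) / ((a - b) * (a - c)) / a - (4 * J * 1 - 4 * 0 * c) / ((c - a) * (c - b)) / c) * cos_integral (c - a) (c - b) +
         ((4 * J * 1 - 4 * 0 * b) / ((b - a) * (b - c)) / b - (4 * J * 1 - 4 * 0 * c) / ((c - a) * (c - b)) / c) * sin_integral (c - a) (c - b))
        = 4 * sqrt 2 * J^2 * ((1 / (x*p*a) - 1 / (p*z*c)) * A - (1 / (x*z*b) + 1 / (p*z*c)) * B)"
        unfolding P p_def[symmetric] z_def[symmetric] A_def[symmetric] B_def[symmetric]
        by (simp add: algebra_simps power2_eq_square)
      also have "\<dots> = 2 * sqrt 2 * V / (x * z * p)"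
        unfolding J2 V_def using xz(1-3) a pos by (simp add: divide_simps) (simp add: algebra_simps)
      finally show "sqrt 2 * J *
        (((4 * J * 1 - 4 * 0 * a) / ((a - b) * (a - c)) / a - (4 * J * 1 - 4 * 0 * c) / ((c - a) * (c - b)) / c) * cos_integral (c - a) (c - b) +
         ((4 * J * 1 - 4 * 0 * b) / ((b - a) * (b - c)) / b - (4 * J * 1 - 4 * 0 * c) / ((c - a) * (c - b)) / c) * sin_integral (c - a) (c - b))
        = 2 * sqrt 2 * V / (x * z * p)" .
    qed (use r E False in auto)
    have "Delta J E = 16 * (U * V + 2 * J^2 * W^2) / (x * z * p)^2"
      unfolding Delta_eq TE PJ PE TJ using xz(1-3)
      by (simp add: divide_simps power2_eq_square) (simp add: algebra_simps)
    also have "U * V + 2 * J^2 * W^2 = x * z * p * (a * (p*A^2 + 2*x*A*B - z*B^2) + x*p*A*(A + 2*B))"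
      using Delta_numerator[where a=a and b=b and c=c and A=A and B=B]
      by (simp add: J2 U_def V_def W_def x_def z_def p_def)
    finally have D: "Delta J E = 16 * (x * z * p * (a * (p*A^2 + 2*x*A*B - z*B^2) + x*p*A*(A + 2*B))) / (x * z * p)^2" .
    \<comment> \<open>The factor \<open>p = x + z\<close> lets the negative term split as
      \<open>z*p*B^2 = z^2*B^2 + x*z*B^2\<close>, so that \<open>p*A - z*B\<close>, nonnegative by
      \<open>AB\<close>, can be factored out and a positive multiple of \<open>B^2\<close>
      remains.\<close>
    have "0 < p * (p*A^2 + 2*x*A*B - z*B^2)"
    proof -
      have "p * (p*A^2 + 2*x*A*B - z*B^2)
        = (p*A - z*B) * (p*A + z*B) + 2*x*B * (p*A - z*B) + x*z*B^2"
        unfolding xz(4) by algebra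
      moreover have "0 \<le> (p*A - z*B) * (p*A + z*B)" "0 \<le> 2*x*B * (p*A - z*B)" "0 < x*z*B^2"
        using AB xz(1-3) by (auto intro!: mult_nonneg_nonneg add_nonneg_nonneg)
      ultimately show ?thesis by linarith
    qed
    then have "0 < p*A^2 + 2*x*A*B - z*B^2" using xz(3) zero_less_mult_pos by blast
    then have "0 < a * (p*A^2 + 2*x*A*B - z*B^2) + x*p*A*(A + 2*B)"
      using a AB xz(1-3) by (intro add_pos_pos mult_pos_pos) auto
    then show ?thesis unfolding D using xz(1-3) by simp
  qed
qed

end
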